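(* Let $U\cong\mathbb{R}^d$ and let $X$ be a compact metric space which is a smooth compact manifold, on which $U$ acts smoothly, with discrete stabilizers, and completely uniquely ergodically. Then for any cross-section $\mathcal{S}\subseteq X$ and any $x_0\in X$, the set of visit times $$\mathcal{D}=\{u\in U: u.x_0\in\mathcal{S}\}$$ is a uniformly discrete set which is a dense forest. In particular, uniformly discrete dense forests exist in $\mathbb{R}^d$ for every $d$.
   Context: A set $Y\subseteq\mathbb{R}^d$ is uniformly discrete if $\inf_{y_1,y_2\in Y,\,y_1\neq y_2}\|y_1-y_2\|>0$. A set $Y\subseteq\mathbb{R}^d$ is a dense forest if there is a function $\varepsilon(T)$ with $\varepsilon(T)\to 0$ as $T\to\infty$ such that for any $x\in\mathbb{R}^d$ and any direction $v\in\mathbb{S}^{d-1}=\{v\in\mathbb{R}^d:\|v\|=1\}$, the distance from $Y$ to the line segment of length $T$ going from $x$ in direction $v$ is at most $\varepsilon(T)$. (Here $U$ is identified with $\mathbb{R}^d$ with its Euclidean norm.) The action of a Lie group $G$ on $X$ is completely uniquely ergodic if there is a Borel probability measure $\mu$ of full support on $X$ such that for any (nontrivial) one-parameter subgroup $H\subseteq G$, $\mu$ is the unique $H$-invariant Borel probability measure on $X$. For a Lie group $G$ acting smoothly and with discrete stabilizers on a compact manifold $X$, a subset $\mathcal{S}\subseteq X$ is a cross-section if: (1) $\mathcal{S}$ is the image under a smooth and injective map of a bounded domain in $\mathbb{R}^k$, where $k=\dim X-\dim G$, and where smooth and injective means that the map extends smoothly and injectively to an open set containing the closure of its domain; (2)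 there is a neighborhood $B$ of the identity in $G$ such that the map $B\times\mathcal{S}\to X$, $(b,s)\mapsto b.s$ is injective and has an open image; (3) for any $x\in X$ there is $g\in G$ such that $g.x\in\mathcal{S}$. *)

theory Defs
  imports "HOL-Analysis.Analysis" "HOL-Probability.Probability_Measure"
begin

text \<open>Uniform discreteness is the library's \<open>uniform_discrete\<close>; the infimum over the pairs of
  distinct points of a set with at most one point is read as infinity.

  In the definition of a dense forest the distance to the empty set is infinite, whereas
  \<open>setdist\<close> to the empty set is 0; hence the explicit condition that \<open>Y\<close> is nonempty.\<close>

definition dense_forest :: "'u::euclidean_space set \<Rightarrow> bool" where
  "dense_forest Y \<longleftrightarrow> Y \<noteq> {} \<and>
     (\<exists>\<epsilon> :: real \<Rightarrow> real. (\<epsilon> \<longlongrightarrow> 0) at_top \<and>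
       (\<forall>T>0. \<forall>x v. norm v = 1 \<longrightarrow> setdist Y (closed_segment x (x + T *\<^sub>R v)) \<le> \<epsilon> T))"


subsection \<open>Smooth manifolds\<close>

text \<open>The maps below are smooth in the usual sense on sets \<open>W\<close> that are open in the whole
  space or open in a linear subspace \<open>V\<close>. In the second case \<open>f' x\<close> is determined by \<open>f\<close> only
  on \<open>V\<close>; it can be taken to vanish on the orthogonal complement of \<open>V\<close>, so that quantifying over
  all directions \<open>v\<close> is the same as quantifying over \<open>v \<in> V\<close>.\<close>

primrec Ck_on ::
  "nat \<Rightarrow> 'e::euclidean_space set \<Rightarrow> ('e \<Rightarrow> 'f::euclidean_space) \<Rightarrow> bool" where
  "Ck_on 0 W f = continuous_on W f"
| "Ck_on (Suc m) W f =
     (\<exists>f'. (\<forall>x\<in>W. (f has_derivative f' x) (at x within W)) \<and> (\<forall>v. Ck_on m W (\<lambda>x. f' x v)))"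

definition smooth_on :: "'e::euclidean_space set \<Rightarrow> ('e \<Rightarrow> 'f::euclidean_space) \<Rightarrow> bool" where
  "smooth_on W f \<longleftrightarrow> (\<forall>m. Ck_on m W f)"

text \<open>A chart is a pair \<open>(D, \<phi>)\<close>; only the values of \<open>\<phi>\<close> on \<open>D\<close> matter.\<close>

type_synonym ('x, 'e) chart = "'x set \<times> ('x \<Rightarrow> 'e)"

text \<open>The manifold \<open>X\<close> has no boundary, carries the topology induced from the ambient type, and has
  dimension \<open>DIM('e)\<close> everywhere. Ranging over both orders of a pair of charts makes the
  transition maps diffeomorphisms.\<close>

definition smooth_manifold ::
  "'x::topological_space set \<Rightarrow> ('x, 'e::euclidean_space) chart set \<Rightarrow> bool" where
  "smooth_manifold X A \<longleftrightarrow>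
     (\<Union>(D, \<phi>)\<in>A. D) = X \<and>
     (\<forall>(D, \<phi>)\<in>A. openin (top_of_set X) D \<and> open (\<phi> ` D) \<and> (\<exists>\<psi>. homeomorphism D (\<phi> ` D) \<phi> \<psi>)) \<and>
     (\<forall>(D, \<phi>)\<in>A. \<forall>(E, \<psi>)\<in>A. smooth_on (\<phi> ` (D \<inter> E)) (\<lambda>z. \<psi> (inv_into D \<phi> z)))"

definition prod_atlas ::
  "('x, 'e) chart set \<Rightarrow> ('y, 'f) chart set \<Rightarrow> ('x \<times> 'y, 'e \<times> 'f) chart set" where
  "prod_atlas A B = {(D \<times> E, map_prod \<phi> \<psi>) | D \<phi> E \<psi>. (D, \<phi>) \<in> A \<and> (E, \<psi>) \<in> B}"

text \<open>The standard atlas of a Euclidean space, of an open subset of it, or of an open subset of a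
  linear subspace.\<close>

definition std_atlas :: "'e set \<Rightarrow> ('e, 'e) chart set" where
  "std_atlas W = {(W, \<lambda>x. x)}"

definition smooth_map ::
  "('x::topological_space, 'e::euclidean_space) chart set \<Rightarrow>
   ('y::topological_space, 'f::euclidean_space) chart set \<Rightarrow> ('x \<Rightarrow> 'y) \<Rightarrow> bool" where
  "smooth_map A B f \<longleftrightarrow>
     continuous_on (\<Union>(D, \<phi>)\<in>A. D) f \<and>
     f ` (\<Union>(D, \<phi>)\<in>A. D) \<subseteq> (\<Union>(E, \<psi>)\<in>B. E) \<and>
     (\<forall>(D, \<phi>)\<in>A. \<forall>(E, \<psi>)\<in>B.
        smooth_on (\<phi> ` {x \<in> D. f x \<in> E}) (\<lambda>z. \<psi> (f (inv_into D \<phi> z))))"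


subsection \<open>Smooth actions of a vector group\<close>

definition smooth_action ::
  "'x::topological_space set \<Rightarrow> ('x, 'e::euclidean_space) chart set \<Rightarrow>
   ('u::euclidean_space \<Rightarrow> 'x \<Rightarrow> 'x) \<Rightarrow> bool" where
  "smooth_action X A act \<longleftrightarrow>
     (\<forall>u. \<forall>x\<in>X. act u x \<in> X) \<and>
     (\<forall>x\<in>X. act 0 x = x) \<and>
     (\<forall>u v. \<forall>x\<in>X. act (u + v) x = act u (act v x)) \<and>
     smooth_map (prod_atlas (std_atlas UNIV) A) A (\<lambda>(u, x). act u x)"

definition discrete_stabilizers :: "'x set \<Rightarrow> ('u::euclidean_space \<Rightarrow> 'x \<Rightarrow> 'x) \<Rightarrow> bool" where
  "discrete_stabilizers X act \<longleftrightarrow> (\<forall>x\<in>X. discrete {u. act u x = x})"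

definition one_parameter_subgroup :: "'u::euclidean_space set \<Rightarrow> bool" where
  "one_parameter_subgroup H \<longleftrightarrow>
     (\<exists>\<gamma> :: real \<Rightarrow> 'u. continuous_on UNIV \<gamma> \<and> (\<forall>s t. \<gamma> (s + t) = \<gamma> s + \<gamma> t) \<and> H = range \<gamma>)"

definition borel_prob_on :: "'x::topological_space set \<Rightarrow> 'x measure \<Rightarrow> bool" where
  "borel_prob_on X \<mu> \<longleftrightarrow> prob_space \<mu> \<and> sets \<mu> = sets (restrict_space borel X)"

definition full_support :: "'x::topological_space set \<Rightarrow> 'x measure \<Rightarrow> bool" where
  "full_support X \<mu> \<longleftrightarrow> (\<forall>O'. openin (top_of_set X) O' \<and> O' \<noteq> {} \<longrightarrow> emeasure \<mu> O' > 0)"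

definition invariant_measure :: "('u \<Rightarrow> 'x \<Rightarrow> 'x) \<Rightarrow> 'u set \<Rightarrow> 'x measure \<Rightarrow> bool" where
  "invariant_measure act H \<mu> \<longleftrightarrow> (\<forall>h\<in>H. distr \<mu> \<mu> (act h) = \<mu>)"

definition completely_uniquely_ergodic ::
  "'x::topological_space set \<Rightarrow> ('u::euclidean_space \<Rightarrow> 'x \<Rightarrow> 'x) \<Rightarrow> bool" where
  "completely_uniquely_ergodic X act \<longleftrightarrow>
     (\<exists>\<mu>. borel_prob_on X \<mu> \<and> full_support X \<mu> \<and>
       (\<forall>H. one_parameter_subgroup H \<and> H \<noteq> {0} \<longrightarrow>
         (\<forall>\<nu>. borel_prob_on X \<nu> \<and> invariant_measure act H \<nu> \<longleftrightarrow> \<nu> = \<mu>)))"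

text \<open>The parameter space of dimension \<open>k = dim X - dim G\<close> is a \<open>k\<close>-dimensional linear subspace \<open>V\<close>
  of the model space \<open>'e\<close> of \<open>X\<close>, rather than a type of its own: \<open>k\<close> may be 0, and no Euclidean
  type has dimension 0. A domain is a nonempty connected open set, here open in \<open>V\<close>.\<close>

definition cross_section ::
  "'x::topological_space set \<Rightarrow> ('x, 'e::euclidean_space) chart set \<Rightarrow>
   ('u::euclidean_space \<Rightarrow> 'x \<Rightarrow> 'x) \<Rightarrow> 'x set \<Rightarrow> bool" where
  "cross_section X A act S \<longleftrightarrow>
     S \<subseteq> X \<and>
     (\<exists>(V :: 'e set) W W' f.
        subspace V \<and> dim V + DIM('u) = DIM('e) \<and>
        openin (top_of_set V) W \<and> connected W \<and> W \<noteq> {} \<and> bounded W \<and>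
        openin (top_of_set V) W' \<and> closure W \<subseteq> W' \<and>
        smooth_map (std_atlas W') A f \<and> inj_on f W' \<and> S = f ` W) \<and>
     (\<exists>B :: 'u set. 0 \<in> interior B \<and>
        inj_on (\<lambda>(b, s). act b s) (B \<times> S) \<and>
        openin (top_of_set X) ((\<lambda>(b, s). act b s) ` (B \<times> S))) \<and>
     (\<forall>x\<in>X. \<exists>g. act g x \<in> S)"

end

theory Submission
  imports Defs "HOL-Probability.Helly_Selection" "HOL-Real_Asymp.Real_Asymp"
begin

text \<open>Visit times to a cross-section are separated because \<open>(b, s) \<mapsto> b.s\<close> is injective near \<open>b = 0\<close>.
  By Baire category the \<open>\<epsilon>\<close>-thickening of the cross-section along the orbits contains a nonempty open
  set \<open>O'\<close>. If orbit segments of unbounded length avoided \<open>O'\<close>, a limit of their midpoints would have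
  an orbit under some line \<open>\<real> v\<close> that avoids \<open>O'\<close>, and averaging along it would give an
  \<open>\<real> v\<close>-invariant probability measure vanishing on \<open>O'\<close>, against unique ergodicity and full support.

  The existence statement is proved without reference to dynamics. The forest is a union of
  sets \<open>Y k\<close>, each much sparser than the free gaps left by its predecessors, so that
  every long segment keeps stretches that are free of the earlier points. For a given \<open>\<epsilon>\<close> the
  points near such stretches are chosen by a derandomized union bound: the number of
  essentially different tubes of length \<open>l\<close> in a ball of radius \<open>l\<close> is polynomial in \<open>l\<close>, while a
  random choice of one candidate per cell misses a tube with probability exponentially small
  in \<open>l\<close>.\<close>

subsection \<open>Sparse sets and porosity\<close>

text \<open>A union bound serves only finitely many tubes, while the tubes of length
  \<open>l\<close> in the whole space have no finite net. So each random choice is confined to the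
  neighbourhood of one centre, centres \<open>6 * l\<close> apart are handled independently, and
  finitely many translates of this pattern reach every starting point. Another obstacle is
  circularity: the size of the cells depends on the porosity bound \<open>L\<close> of the earlier
  points, and this bound roughly doubles with each set that is added. It is resolved because the
  number of sets spent on one \<open>\<epsilon>\<close> is the same for all
  \<open>\<epsilon>\<close> and \<open>L\<close>, so a bound valid throughout the block is available
  before its cells are chosen. Deducing existence from the dynamical part would instead require an
  action with all these properties to be exhibited for every dimension.\<close>

definition porous :: "real \<Rightarrow> 'a::real_normed_vector set \<Rightarrow> bool" where
  "porous L Z \<longleftrightarrow>
     (\<forall>x v. norm v = 1 \<longrightarrow> (\<exists>t\<in>{0..L}. \<forall>z\<in>Z. 1 \<le> dist (x + t *\<^sub>R v) z))"

definition separated :: "real \<Rightarrow> 'a::metric_space set \<Rightarrow> bool" where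
  "separated R Y \<longleftrightarrow> (\<forall>y\<in>Y. \<forall>z\<in>Y. y \<noteq> z \<longrightarrow> R \<le> dist y z)"

lemma porous_mono: "porous L Z \<Longrightarrow> L \<le> L' \<Longrightarrow> porous L' Z"
  unfolding porous_def by (meson atLeastAtMost_iff order_trans)

lemma separated_mono: "separated R Y \<Longrightarrow> R' \<le> R \<Longrightarrow> separated R' Y"
  unfolding separated_def by (meson order_trans)

lemma dist_line:
  fixes v :: "'a::real_normed_vector"
  assumes "norm v = 1"
  shows "dist (x + s *\<^sub>R v) (x + t *\<^sub>R v) = \<bar>s - t\<bar>"
proof -
  have "dist (x + s *\<^sub>R v) (x + t *\<^sub>R v) = norm ((s - t) *\<^sub>R v)"
    by (simp add: dist_norm scaleR_left_diff_distrib)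
  then show ?thesis using assms by simp
qed

text \<open>Of two free stretches of length \<open>L\<close>, a distance 2 apart, the sparse set \<open>Y\<close> can spoil
  only one.\<close>

lemma porous_Un:
  assumes Z: "porous L Z" and Y: "separated (2 * L + 4) Y" and L: "0 \<le> L"
  shows "porous (2 * L + 2) (Z \<union> Y)"
  unfolding porous_def
proof (intro allI impI)
  fix x v :: 'a assume v: "norm v = 1"
  obtain s where s: "s \<in> {0..L}" "\<forall>z\<in>Z. 1 \<le> dist (x + s *\<^sub>R v) z"
    using Z v unfolding porous_def by blast
  obtain t' where t': "t' \<in> {0..L}" "\<forall>z\<in>Z. 1 \<le> dist ((x + (L + 2) *\<^sub>R v) + t' *\<^sub>R v) z"
    using Z v unfolding porous_def by blast
  \<comment> \<open>Then 2 \<le> \<open>t - s\<close> \<le> \<open>2 * L + 2\<close>. One point of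
    \<open>Y\<close> within 1 of both positions would force \<open>t - s < 2\<close>; two different
    ones would be less than \<open>2 * L + 4\<close> apart.\<close>
  define t where "t = L + 2 + t'"
  have xt: "(x + (L + 2) *\<^sub>R v) + t' *\<^sub>R v = x + t *\<^sub>R v"
    by (simp add: t_def algebra_simps)
  have st: "dist (x + s *\<^sub>R v) (x + t *\<^sub>R v) = t - s"
    using dist_line[OF v, of x s t] s t' by (simp add: t_def)
  have "(\<forall>y\<in>Y. 1 \<le> dist (x + s *\<^sub>R v) y) \<or> (\<forall>y\<in>Y. 1 \<le> dist (x + t *\<^sub>R v) y)"
  proof (rule ccontr)
    assume "\<not> ?thesis"
    then obtain y y' where y: "y \<in> Y" "y' \<in> Y" "dist (x + s *\<^sub>R v) y < 1"
      "dist (x + t *\<^sub>R v) y' < 1" by force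
    have d: "dist y y' < 2 + (t - s)" and d2: "t - s < dist y y' + 2"
      using y(3,4) st dist_triangle[of y y' "x + s *\<^sub>R v"] dist_triangle[of "x + s *\<^sub>R v" y' "x + t *\<^sub>R v"]
        dist_triangle[of "x + s *\<^sub>R v" "x + t *\<^sub>R v" y] dist_triangle[of y "x + t *\<^sub>R v" y']
      by (simp_all add: dist_commute)
    show False
    proof (cases "y = y'")
      case True
      with d2 s t' show False by (simp add: t_def)
    next
      case False
      with Y y have "2 * L + 4 \<le> dist y y'" by (auto simp: separated_def)
      with d s t' show False by (simp add: t_def)
    qed
  qed
  with s t' xt L show "\<exists>t\<in>{0..2 * L + 2}. \<forall>z\<in>Z \<union> Y. 1 \<le> dist (x + t *\<^sub>R v) z"
    by (elim disjE) (rule bexI[of _ s] bexI[of _ t]; auto simp: t_def)+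
qed

text \<open>A requirement that can still be met after any earlier stages of porosity
  \<open>L\<close>: \<open>2 * L + 4\<close> is the sparseness that \<open>porous_Un\<close> asks
  for, and the distance 1/2 to \<open>Z\<close> keeps the union uniformly discrete.\<close>

definition achievable :: "real \<Rightarrow> ('a::real_normed_vector set \<Rightarrow> bool) \<Rightarrow> bool" where
  "achievable L Q \<longleftrightarrow>
     (\<forall>Z. porous L Z \<longrightarrow>
       (\<exists>Y. separated (2 * L + 4) Y \<and> (\<forall>y\<in>Y. \<forall>z\<in>Z. 1/2 \<le> dist y z) \<and> Q Y))"

text \<open>A larger \<open>L\<close> admits more sets \<open>Z\<close> and asks for a sparser
  \<open>Y\<close>. So a bound valid at the end of a block of requirements serves all of
  them.\<close>

lemma achievable_antimono: "achievable L Q \<Longrightarrow> L' \<le> L \<Longrightarrow> achievable L' Q"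
  unfolding achievable_def
  by (meson porous_mono separated_mono add_right_mono mult_left_mono zero_le_numeral)

text \<open>The recursion for \<open>L\<close> is that of \<open>porous_Un\<close>, so every partial
  union stays porous enough for the next requirement. Separation concerns two points at a time and
  passes to the increasing union; monotonicity carries each requirement there.\<close>

lemma achieve_sequence:
  fixes Q :: "nat \<Rightarrow> 'a::real_normed_vector set \<Rightarrow> bool"
  assumes Q: "\<And>k. achievable (L k) (Q k)" and "0 \<le> L 0" and L: "\<And>k. L (Suc k) = 2 * L k + 2"
    and mono: "\<And>k Y Y'. Q k Y \<Longrightarrow> Y \<subseteq> Y' \<Longrightarrow> Q k Y'"
  shows "\<exists>Y. separated (1/2) Y \<and> (\<forall>k. Q k Y)"
proof -
  have L0: "0 \<le> L k" for k by (induction k) (use assms in auto)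
  define F where "F k Z = (SOME Y. separated (2 * L k + 4) Y \<and> (\<forall>y\<in>Y. \<forall>z\<in>Z. 1/2 \<le> dist y z) \<and> Q k Y)" for k Z
  have F: "separated (2 * L k + 4) (F k Z) \<and> (\<forall>y\<in>F k Z. \<forall>z\<in>Z. 1/2 \<le> dist y z) \<and> Q k (F k Z)"
    if "porous (L k) Z" for k Z
    unfolding F_def by (rule someI_ex) (use Q[of k] that in \<open>auto simp: achievable_def\<close>)
  define Z where "Z = rec_nat {} (\<lambda>k Z. Z \<union> F k Z)"
  have Z_simps: "Z 0 = {}" "Z (Suc k) = Z k \<union> F k (Z k)" for k by (simp_all add: Z_def)
  have porous: "porous (L k) (Z k)" for k
  proof (induction k)
    case 0
    then show ?case using assms(2) by (auto simp: porous_def Z_simps)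
  next
    case (Suc k)
    then show ?case using F[OF Suc] porous_Un[of "L k" "Z k" "F k (Z k)"] L0 by (simp add: Z_simps L)
  qed
  have Zmono: "i \<le> j \<Longrightarrow> Z i \<subseteq> Z j" for i j
    by (rule lift_Suc_mono_le[of Z]) (auto simp: Z_simps)
  have sep: "separated (1/2) (Z k)" for k
  proof (induction k)
    case 0
    then show ?case by (auto simp: separated_def Z_simps)
  next
    case (Suc k)
    have "separated (1/2) (F k (Z k))"
      by (rule separated_mono[of "2 * L k + 4"]) (use F[OF porous] L0[of k] in auto)
    with Suc F[OF porous, of k] show ?case
      unfolding separated_def Z_simps by (metis Un_iff dist_commute)
  qed
  have "separated (1/2) (\<Union>k. Z k)"
    unfolding separated_def
  proof (intro ballI impI)
    fix y z assume "y \<in> (\<Union>k. Z k)" "z \<in> (\<Union>k. Z k)" "y \<noteq> z"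
    then obtain i j where "y \<in> Z i" "z \<in> Z j" by auto
    then have "y \<in> Z (max i j)" "z \<in> Z (max i j)"
      using Zmono[of i "max i j"] Zmono[of j "max i j"] by auto
    with sep[of "max i j"] \<open>y \<noteq> z\<close> show "1/2 \<le> dist y z" by (auto simp: separated_def)
  qed
  moreover have "Q k (\<Union>k. Z k)" for k
    by (rule mono[of k "F k (Z k)"]) (use F[OF porous, of k] Z_simps(2)[of k] in auto)
  ultimately show ?thesis by blast
qed

text \<open>The weight of \<open>\<tau>\<close> is the chance that independent uniform choices from the remaining
  \<open>Cand i\<close> all miss \<open>\<tau>\<close>; choosing greedily keeps the total weight below 1.\<close>

lemma greedy_hitting:
  fixes Cand :: "'i \<Rightarrow> 'p set" and hit :: "'t \<Rightarrow> 'p \<Rightarrow> bool" and J :: "'t \<Rightarrow> 'i set"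
  assumes "finite I" and "finite T" and "1 \<le> N"
    and "\<And>i. i \<in> I \<Longrightarrow> finite (Cand i) \<and> Cand i \<noteq> {} \<and> card (Cand i) \<le> N"
    and "\<And>\<tau> i. \<tau> \<in> T \<Longrightarrow> i \<in> I \<Longrightarrow> i \<in> J \<tau> \<Longrightarrow> \<exists>q\<in>Cand i. hit \<tau> q"
    and "(\<Sum>\<tau>\<in>T. (1 - 1 / real N) ^ card (J \<tau> \<inter> I)) < 1"
  shows "\<exists>\<phi>. (\<forall>i\<in>I. \<phi> i \<in> Cand i) \<and> (\<forall>\<tau>\<in>T. \<exists>i\<in>I. hit \<tau> (\<phi> i))"
  using assms
proof (induction I arbitrary: T rule: finite_induct)
  case empty
  then have "T = {}" by simp
  then show ?case by auto
next
  case (insert i I)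
  define r where "r = 1 - 1 / real N"
  have r: "0 \<le> r" using insert.prems(2) by (simp add: r_def)
  define w where "w \<tau> = r ^ card (J \<tau> \<inter> I)" for \<tau>
  define n where "n = card (Cand i)"
  have n: "0 < n" "n \<le> N" "finite (Cand i)"
    using insert.prems(3)[of i] by (auto simp: n_def card_gt_0_iff)
  \<comment> \<open>The weight that survives the choice \<open>q\<close>, summed over all
    candidates: once this is below \<open>n\<close>, some \<open>q\<close> leaves weight below
    1.\<close>
  have "(\<Sum>q\<in>Cand i. \<Sum>\<tau>\<in>{\<tau>\<in>T. \<not> hit \<tau> q}. w \<tau>) = (\<Sum>q\<in>Cand i. \<Sum>\<tau>\<in>T. if hit \<tau> q then 0 else w \<tau>)"
    using insert.prems(1) by (intro sum.cong refl sum.mono_neutral_cong_left) auto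
  also have "\<dots> = (\<Sum>\<tau>\<in>T. \<Sum>q\<in>Cand i. if hit \<tau> q then 0 else w \<tau>)"
    by (rule sum.swap)
  also have "\<dots> \<le> (\<Sum>\<tau>\<in>T. real n * r ^ card (J \<tau> \<inter> insert i I))"
  proof (rule sum_mono)
    fix \<tau> assume \<tau>: "\<tau> \<in> T"
    have w: "0 \<le> w \<tau>" using r by (simp add: w_def)
    have "(\<Sum>q\<in>Cand i. if hit \<tau> q then 0 else w \<tau>) = (\<Sum>q\<in>{q\<in>Cand i. \<not> hit \<tau> q}. w \<tau>)"
      using n(3) by (intro sum.mono_neutral_cong_right) auto
    then have eq: "(\<Sum>q\<in>Cand i. if hit \<tau> q then 0 else w \<tau>) = real (card {q\<in>Cand i. \<not> hit \<tau> q}) * w \<tau>"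
      by simp
    show "(\<Sum>q\<in>Cand i. if hit \<tau> q then 0 else w \<tau>) \<le> real n * r ^ card (J \<tau> \<inter> insert i I)"
    proof (cases "i \<in> J \<tau>")
      case True
      then obtain q where q: "q \<in> Cand i" "hit \<tau> q" using insert.prems(4)[OF \<tau>] by auto
      have "card {q\<in>Cand i. \<not> hit \<tau> q} < n"
        unfolding n_def by (rule psubset_card_mono) (use n q in auto)
      then have "real (card {q\<in>Cand i. \<not> hit \<tau> q}) \<le> real n - 1" by linarith
      \<comment> \<open>Uses \<open>n \<le> N\<close>: one hit among \<open>n\<close> candidates is
        at least a fraction \<open>1 / N\<close> of them.\<close>
      also have "\<dots> \<le> real n * r"
        using n by (simp add: r_def field_simps)
      finally have "real (card {q\<in>Cand i. \<not> hit \<tau> q}) * w \<tau> \<le> real n * r * w \<tau>"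
        using w by (rule mult_right_mono)
      moreover have "J \<tau> \<inter> insert i I = insert i (J \<tau> \<inter> I)" using True by auto
      ultimately show ?thesis
        unfolding eq using insert.hyps by (simp add: w_def mult.assoc)
    next
      case False
      have "card {q\<in>Cand i. \<not> hit \<tau> q} \<le> n"
        unfolding n_def by (rule card_mono) (use n in auto)
      moreover have "J \<tau> \<inter> insert i I = J \<tau> \<inter> I" using False by auto
      ultimately show ?thesis
        unfolding eq using w by (simp add: w_def mult_right_mono)
    qed
  qed
  also have "\<dots> = real n * (\<Sum>\<tau>\<in>T. r ^ card (J \<tau> \<inter> insert i I))"
    by (simp add: sum_distrib_left)
  also have "\<dots> < real n * 1"
    using insert.prems(5) n by (intro mult_strict_left_mono) (auto simp: r_def)
  finally have *: "(\<Sum>q\<in>Cand i. \<Sum>\<tau>\<in>{\<tau>\<in>T. \<not> hit \<tau> q}. w \<tau>) < real n" by simp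
  have "\<exists>q\<in>Cand i. (\<Sum>\<tau>\<in>{\<tau>\<in>T. \<not> hit \<tau> q}. w \<tau>) < 1"
  proof (rule ccontr)
    assume "\<not> ?thesis"
    then have "(\<Sum>q\<in>Cand i. 1) \<le> (\<Sum>q\<in>Cand i. \<Sum>\<tau>\<in>{\<tau>\<in>T. \<not> hit \<tau> q}. w \<tau>)"
      by (intro sum_mono) (auto simp: not_less)
    with * show False by (simp add: n_def)
  qed
  then obtain q where q: "q \<in> Cand i" "(\<Sum>\<tau>\<in>{\<tau>\<in>T. \<not> hit \<tau> q}. w \<tau>) < 1" by blast
  have "\<exists>\<phi>. (\<forall>i\<in>I. \<phi> i \<in> Cand i) \<and> (\<forall>\<tau>\<in>{\<tau>\<in>T. \<not> hit \<tau> q}. \<exists>i\<in>I. hit \<tau> (\<phi> i))"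
    by (rule insert.IH) (use insert.prems q in \<open>auto simp: w_def r_def\<close>)
  then obtain \<phi> where \<phi>: "\<forall>i\<in>I. \<phi> i \<in> Cand i" "\<forall>\<tau>\<in>{\<tau>\<in>T. \<not> hit \<tau> q}. \<exists>i\<in>I. hit \<tau> (\<phi> i)"
    by blast
  show ?case
    by (rule exI[of _ "\<phi>(i := q)"]) (use \<phi> q insert.hyps in auto)
qed

subsection \<open>Hitting all tubes of a fixed length\<close>

text \<open>The integer lattice is translated by a finite net of the unit cube. The tolerance 1/6
  serves at two scales: at scale \<open>\<rho>\<close> it leaves room in a cell of radius
  \<open>\<rho> / 3\<close> for a walk of length \<open>L\<close>, and at scale \<open>6 * l\<close>
  it puts every starting point within \<open>l\<close> of a centre.\<close>

lemma separated_lattice_cover: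
  "\<exists>q (\<Lambda> :: nat \<Rightarrow> 'a::euclidean_space set). (\<forall>i<q. separated 1 (\<Lambda> i)) \<and>
     (\<forall>x. \<exists>i<q. \<exists>y\<in>\<Lambda> i. dist x y \<le> 1/6)"
proof -
  define Z where "Z = {x::'a. \<forall>b\<in>Basis. x \<bullet> b \<in> \<int>}"
  have Z: "separated 1 Z"
    unfolding separated_def
  proof (intro ballI impI)
    fix y z :: 'a assume yz: "y \<in> Z" "z \<in> Z" "y \<noteq> z"
    then obtain b where b: "b \<in> Basis" "y \<bullet> b \<noteq> z \<bullet> b" by (auto simp: euclidean_eq_iff[of y z])
    then have "(y - z) \<bullet> b \<in> \<int>" "(y - z) \<bullet> b \<noteq> 0" using yz by (auto simp: Z_def inner_diff_left)
    then have "1 \<le> \<bar>(y - z) \<bullet> b\<bar>" by (rule Ints_nonzero_abs_ge1)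
    also have "\<dots> \<le> dist y z" using Basis_le_norm[OF b(1)] by (simp add: dist_norm)
    finally show "1 \<le> dist y z" .
  qed
  obtain F where F: "finite F" "cbox 0 (One::'a) \<subseteq> (\<Union>f\<in>F. ball f (1/6))"
    using compact_cbox[of 0 "One::'a"] seq_compact_imp_totally_bounded
    by (metis compact_eq_seq_compact_metric zero_less_divide_1_iff zero_less_numeral)
  obtain f :: "nat \<Rightarrow> 'a" and q where f: "F = f ` {..<q}"
    using F(1) by (metis finite_imp_nat_seg_image_inj_on lessThan_def)
  show ?thesis
  proof (rule exI[of _ q], rule exI[of _ "\<lambda>i. (+) (f i) ` Z"], intro conjI allI impI)
    show "separated 1 ((+) (f i) ` Z)" for i
      using Z by (auto simp: separated_def)
    fix x :: 'a
    define z where "z = (\<Sum>b\<in>Basis. of_int \<lfloor>x \<bullet> b\<rfloor> *\<^sub>R b)"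
    have z: "z \<bullet> b = of_int \<lfloor>x \<bullet> b\<rfloor>" if "b \<in> Basis" for b
      using that by (simp add: z_def)
    have "x - z \<in> cbox 0 One"
      using z by (auto simp: mem_box inner_diff_left) linarith
    then obtain i where i: "i < q" "dist (f i) (x - z) < 1/6" using F(2) f by auto
    have "z \<in> Z" using z by (simp add: Z_def)
    moreover have "dist x (f i + z) = dist (f i) (x - z)"
      by (simp add: dist_norm norm_minus_commute algebra_simps)
    ultimately show "\<exists>i<q. \<exists>y\<in>(+) (f i) ` Z. dist x y \<le> 1/6"
      using i by (intro exI[of _ i]) force
  qed
qed

text \<open>A ball of radius \<open>2 * s\<close> is covered by \<open>A\<close> balls of radius
  \<open>s\<close>, with the same \<open>A\<close> at every scale. Iteration makes covering numbers
  polynomial in the ratio \<open>2 ^ n\<close> of the radii.\<close>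

lemma doubling_cover:
  "\<exists>A. \<forall>n r. 0 < r \<longrightarrow> (\<exists>N. finite N \<and> card N \<le> A ^ n \<and>
     cball (0::'a::euclidean_space) (2 ^ n * r) \<subseteq> (\<Union>y\<in>N. cball y r))"
proof -
  obtain F where F: "finite F" "cball (0::'a) 2 \<subseteq> (\<Union>f\<in>F. ball f 1)"
    using compact_cball[of "0::'a" 2] seq_compact_imp_totally_bounded by (metis compact_eq_seq_compact_metric zero_less_one)
  have "\<exists>N. finite N \<and> card N \<le> card F ^ n \<and> cball (0::'a) (2 ^ n * r) \<subseteq> (\<Union>y\<in>N. cball y r)"
    if r: "0 < r" for n and r :: real
  proof (induction n)
    case 0
    show ?case by (rule exI[of _ "{0}"]) auto
  next
    case (Suc n)
    then obtain N where N: "finite N" "card N \<le> card F ^ n"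
      "cball (0::'a) (2 ^ n * r) \<subseteq> (\<Union>y\<in>N. cball y r)"
      by blast
    define s where "s = 2 ^ n * r"
    have s: "0 < s" using r by (simp add: s_def)
    define N' where "N' = (\<lambda>(a, y). s *\<^sub>R a + y) ` (F \<times> N)"
    have "card N' \<le> card (F \<times> N)" unfolding N'_def by (rule card_image_le) (use F N in auto)
    also have "\<dots> \<le> card F ^ Suc n" using N(2) by (simp add: card_cartesian_product)
    finally have "card N' \<le> card F ^ Suc n" .
    moreover have "cball (0::'a) (2 ^ Suc n * r) \<subseteq> (\<Union>y\<in>N'. cball y r)"
    proof
      fix x :: 'a assume "x \<in> cball 0 (2 ^ Suc n * r)"
      then have "norm x \<le> 2 * s" by (simp add: s_def)
      then have "(1 / s) *\<^sub>R x \<in> cball 0 2" using s by (simp add: field_simps)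
      then have "(1 / s) *\<^sub>R x \<in> (\<Union>f\<in>F. ball f 1)" using F(2) by blast
      then obtain a where a: "a \<in> F" "dist a ((1 / s) *\<^sub>R x) < 1" by auto
      have "x - s *\<^sub>R a = s *\<^sub>R ((1 / s) *\<^sub>R x - a)" using s by (simp add: algebra_simps)
      then have "norm (x - s *\<^sub>R a) = s * dist a ((1 / s) *\<^sub>R x)"
        using s by (simp add: dist_norm norm_minus_commute)
      also have "\<dots> \<le> s" using a s by simp
      finally have "x - s *\<^sub>R a \<in> cball 0 (2 ^ n * r)" by (simp add: s_def)
      then obtain y where y: "y \<in> N" "dist y (x - s *\<^sub>R a) \<le> r" using N(3) by auto
      have "dist (s *\<^sub>R a + y) x \<le> r" using y(2) by (simp add: dist_norm algebra_simps)
      then show "x \<in> (\<Union>y\<in>N'. cball y r)" using a y by (force simp: N'_def)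
    qed
    moreover have "finite N'" using F N by (simp add: N'_def)
    ultimately show ?case by blast
  qed
  then show ?thesis by blast
qed

text \<open>The tube length will be proportional to \<open>2 ^ m\<close>: the number of tubes is
  polynomial in it and the chance of missing one exponentially small. After taking logarithms, a
  linear function of \<open>m\<close> competes with \<open>2 ^ m\<close>.\<close>

lemma double_exponential_wins:
  fixes r :: real
  assumes "0 < r" "r < 1"
  shows "\<exists>m. real (A ^ (m + k)) ^ 2 * r ^ (2 ^ m) < 1"
proof -
  define a where "a = ln (real A + 1)"
  define c where "c = - ln r"
  have c: "0 < c" using assms by (simp add: c_def)
  have "eventually (\<lambda>m::nat. 2 * a * (real m + real k) < c * 2 ^ m) at_top"
    using c by real_asymp
  then obtain m where m: "2 * a * (real m + real k) < c * 2 ^ m"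
    by (auto simp: eventually_at_top_linorder)
  have "real (A ^ (m + k)) ^ 2 * r ^ (2 ^ m) \<le> ((real A + 1) ^ (m + k)) ^ 2 * r ^ (2 ^ m)"
    using assms by (auto intro!: mult_right_mono power_mono)
  also have "\<dots> = exp (a * (2 * (real m + real k))) * exp (- (c * 2 ^ m))"
  proof -
    have "exp a = real A + 1" "exp (- c) = r" using assms by (simp_all add: a_def c_def)
    moreover have "exp (a * (2 * (real m + real k))) = exp a ^ ((m + k) * 2)"
      by (simp add: exp_of_nat_mult[symmetric] algebra_simps)
    moreover have "exp (- (c * 2 ^ m)) = exp (- c) ^ (2 ^ m)"
      by (simp add: exp_of_nat_mult[symmetric] algebra_simps)
    ultimately show ?thesis by (simp only: power_mult)
  qed
  also have "\<dots> = exp (2 * a * (real m + real k) - c * 2 ^ m)"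
    by (simp add: exp_add[symmetric] algebra_simps)
  also have "\<dots> < 1" using m by simp
  finally show ?thesis by blast
qed

text \<open>By convexity of the norm. It allows a tube to be discretized through its two ends
  alone.\<close>

lemma dist_convex_combination_le:
  fixes x v :: "'a::real_normed_vector"
  assumes "dist x x' \<le> e" "dist (x + l *\<^sub>R v) (x' + l *\<^sub>R v') \<le> e" "0 \<le> t" "t \<le> l" "0 < l"
  shows "dist (x + t *\<^sub>R v) (x' + t *\<^sub>R v') \<le> e"
proof -
  define s where "s = t / l"
  have s: "0 \<le> s" "s \<le> 1" "t = s * l" using assms by (auto simp: s_def)
  have "(x + t *\<^sub>R v) - (x' + t *\<^sub>R v') = (1 - s) *\<^sub>R (x - x') + s *\<^sub>R ((x + l *\<^sub>R v) - (x' + l *\<^sub>R v'))"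
    by (simp add: s(3) algebra_simps)
  then have "dist (x + t *\<^sub>R v) (x' + t *\<^sub>R v') \<le>
      (1 - s) * dist x x' + s * dist (x + l *\<^sub>R v) (x' + l *\<^sub>R v')"
    unfolding dist_norm using norm_triangle_ineq[of "(1 - s) *\<^sub>R (x - x')" "s *\<^sub>R ((x + l *\<^sub>R v) - (x' + l *\<^sub>R v'))"] s
    by simp
  also have "\<dots> \<le> (1 - s) * e + s * e"
    using assms s by (intro add_mono mult_left_mono) auto
  finally show ?thesis by (simp add: algebra_simps)
qed

text \<open>Indices of samples are counted in place of cells: for a unit vector \<open>v\<close> the
  samples are at least \<open>\<rho>\<close> apart, so no two of them come within
  \<open>\<rho> / 6\<close> of the same point of \<open>C\<close>.\<close>

definition cells_met :: "real \<Rightarrow> 'a::real_normed_vector set \<Rightarrow> nat \<Rightarrow> 'a \<Rightarrow> 'a \<Rightarrow> nat set" where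
  "cells_met \<rho> C M x v = {j. j < M \<and> (\<exists>c\<in>C. dist (x + (real j * \<rho>) *\<^sub>R v) c \<le> \<rho> / 6)}"

text \<open>The cells are the balls of radius \<open>\<rho> / 3\<close> about the points of \<open>C\<close>, and \<open>G\<close> supplies the
  candidate points in each cell. The points of \<open>N\<close> serve to discretize the tubes of length \<open>l\<close> near a
  given point, so \<open>few\<close> says that the expected number of missed tubes is less than 1.\<close>

locale cell_setup =
  fixes L \<epsilon> \<rho> l :: real and C :: "'a::real_normed_vector set" and M K :: nat and G N :: "'a set"
    and Z :: "'a set"
  assumes L: "0 \<le> L" and eps: "0 < \<epsilon>" "\<epsilon> \<le> 1/2" and rho: "\<rho> = 6 * (L + 2)"
    and M: "0 < M" and l: "l = real M * \<rho>"
    and C: "separated \<rho> C"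
    and G: "finite G" "G \<subseteq> cball 0 (\<rho> / 3)" "cball 0 (\<rho> / 3) \<subseteq> (\<Union>g\<in>G. cball g (\<epsilon> / 2))"
    and N: "finite N" "cball 0 (2 * l) \<subseteq> (\<Union>y\<in>N. cball y (\<epsilon> / 4))"
    and few: "real (card N) ^ 2 * (1 - 1 / real (card G + 1)) ^ K < 1"
    and Z: "porous L Z"
begin

text \<open>Restricted to the tubes that meet enough cells of this particular \<open>C\<close>; the
  others fall to other translates.\<close>

definition tubes :: "'a \<Rightarrow> ('a \<times> 'a) set" where
  "tubes d = {(x, v). norm v = 1 \<and> dist x d \<le> l \<and> K \<le> card (cells_met \<rho> C M x v)}"

lemma rho_pos: "12 \<le> \<rho>" and rho_le_l: "\<rho> \<le> l"
proof -
  show "12 \<le> \<rho>" using L rho by simp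
  then show "\<rho> \<le> l" unfolding l using M by (simp add: mult_le_cancel_right1)
qed

text \<open>One tube is kept for each pair of net points near the two ends, hence the square.
  Representatives are taken among the tubes themselves, so that they too meet at least
  \<open>K\<close> cells.\<close>

lemma finite_tube_net:
  "\<exists>T. finite T \<and> T \<subseteq> tubes d \<and> card T \<le> card N ^ 2 \<and>
     (\<forall>(x, v)\<in>tubes d. \<exists>(x', v')\<in>T. \<forall>t\<in>{0..l}. dist (x + t *\<^sub>R v) (x' + t *\<^sub>R v') \<le> \<epsilon> / 2)"
proof -
  have l0: "0 < l" using rho_pos rho_le_l by simp
  have ex: "\<exists>a\<in>N. dist a (y - d) \<le> \<epsilon> / 4" if "dist y d \<le> 2 * l" for y
  proof -
    have "y - d \<in> cball 0 (2 * l)" using that by (simp add: dist_norm norm_minus_commute)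
    then have "y - d \<in> (\<Union>a\<in>N. cball a (\<epsilon> / 4))" using N(2) by blast
    then show ?thesis by auto
  qed
  define near where "near y = (SOME a. a \<in> N \<and> dist a (y - d) \<le> \<epsilon> / 4)" for y
  have near: "near y \<in> N \<and> dist (near y) (y - d) \<le> \<epsilon> / 4" if "dist y d \<le> 2 * l" for y
    unfolding near_def by (rule someI_ex) (use ex[OF that] in blast)
  define \<kappa> where "\<kappa> = (\<lambda>(x, v). (near x, near (x + l *\<^sub>R v)))"
  have d: "dist x d \<le> 2 * l" "dist (x + l *\<^sub>R v) d \<le> 2 * l" if "(x, v) \<in> tubes d" for x v
  proof -
    have "dist x d \<le> l" "norm v = 1" using that by (auto simp: tubes_def)
    then show "dist x d \<le> 2 * l" "dist (x + l *\<^sub>R v) d \<le> 2 * l"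
      using l0 dist_triangle[of "x + l *\<^sub>R v" d x] by (auto simp: dist_norm)
  qed
  have \<kappa>: "\<kappa> ` tubes d \<subseteq> N \<times> N" using near d by (auto simp: \<kappa>_def)
  define T where "T = inv_into (tubes d) \<kappa> ` \<kappa> ` tubes d"
  have fin: "finite (\<kappa> ` tubes d)" using finite_subset[OF \<kappa>] N(1) by simp
  have "card T \<le> card (\<kappa> ` tubes d)" unfolding T_def by (rule card_image_le[OF fin])
  also have "\<dots> \<le> card (N \<times> N)" by (rule card_mono) (use \<kappa> N(1) in auto)
  finally have "card T \<le> card N ^ 2" by (simp add: card_cartesian_product power2_eq_square)
  moreover have "T \<subseteq> tubes d" unfolding T_def using inv_into_into[of _ \<kappa> "tubes d"] by blast
  moreover have "\<exists>(x', v')\<in>T. \<forall>t\<in>{0..l}. dist (x + t *\<^sub>R v) (x' + t *\<^sub>R v') \<le> \<epsilon> / 2"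
    if xv: "(x, v) \<in> tubes d" for x v
  proof -
    obtain x' v' where x'v': "inv_into (tubes d) \<kappa> (\<kappa> (x, v)) = (x', v')" by fastforce
    then have T: "(x', v') \<in> T" using xv by (force simp: T_def)
    have mem: "(x', v') \<in> tubes d" using T \<open>T \<subseteq> tubes d\<close> by blast
    have "\<kappa> (x', v') = \<kappa> (x, v)" using xv x'v' by (metis f_inv_into_f imageI)
    then have eq: "near x' = near x" "near (x' + l *\<^sub>R v') = near (x + l *\<^sub>R v)" by (auto simp: \<kappa>_def)
    have close: "dist y y' \<le> \<epsilon> / 2" if "near y' = near y" "dist y d \<le> 2 * l" "dist y' d \<le> 2 * l" for y y'
    proof -
      have "dist (y - d) (y' - d) \<le> \<epsilon> / 4 + \<epsilon> / 4"
        by (rule dist_triangle_le[of _ "near y"]) (use near[OF that(2)] near[OF that(3)] that(1) in \<open>simp add: dist_commute\<close>)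
      then show ?thesis by (simp add: dist_norm)
    qed
    show ?thesis
      using T dist_convex_combination_le[OF close[OF eq(1)] close[OF eq(2)], OF d(1)[OF xv] d(1)[OF mem] d(2)[OF xv] d(2)[OF mem]] l0
      by force
  qed
  moreover have "finite T" using fin by (simp add: T_def)
  ultimately show ?thesis by blast
qed

text \<open>The cells met by the finite net of tubes go into \<open>greedy_hitting\<close>. Net
  tubes are hit within \<open>\<epsilon> / 2\<close>; the other \<open>\<epsilon> / 2\<close> pays
  for passing from an arbitrary tube to the net.\<close>

lemma local_choice:
  "\<exists>\<phi> I. I \<subseteq> C \<and> (\<forall>c\<in>I. dist c d < 3 * l \<and> dist c (\<phi> c) \<le> \<rho> / 3 \<and> (\<forall>z\<in>Z. 1/2 \<le> dist (\<phi> c) z)) \<and>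
     (\<forall>(x, v)\<in>tubes d. \<exists>t\<in>{0..l}. \<exists>c\<in>I. dist (x + t *\<^sub>R v) (\<phi> c) \<le> \<epsilon>)"
proof -
  obtain T where T: "finite T" "T \<subseteq> tubes d" "card T \<le> card N ^ 2"
    "\<And>x v. (x, v) \<in> tubes d \<Longrightarrow> \<exists>x' v'. (x', v') \<in> T \<and> (\<forall>t\<in>{0..l}. dist (x + t *\<^sub>R v) (x' + t *\<^sub>R v') \<le> \<epsilon> / 2)"
    using finite_tube_net[of d] by fast
  define B where "B \<tau> = cells_met \<rho> C M (fst \<tau>) (snd \<tau>)" for \<tau>
  define s where "s \<tau> j = fst \<tau> + (real j * \<rho>) *\<^sub>R snd \<tau>" for \<tau> :: "'a \<times> 'a" and j :: nat
  define cell where "cell \<tau> j = (SOME c. c \<in> C \<and> dist (s \<tau> j) c \<le> \<rho> / 6)" for \<tau> j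
  have cell: "cell \<tau> j \<in> C \<and> dist (s \<tau> j) (cell \<tau> j) \<le> \<rho> / 6" if "j \<in> B \<tau>" for \<tau> j
    unfolding cell_def by (rule someI_ex) (use that in \<open>auto simp: B_def cells_met_def s_def\<close>)
  define J where "J \<tau> = cell \<tau> ` B \<tau>" for \<tau>
  define I where "I = (\<Union>\<tau>\<in>T. J \<tau>)"
  have finB: "finite (B \<tau>)" and ltM: "j \<in> B \<tau> \<Longrightarrow> j < M" for \<tau> j by (auto simp: B_def cells_met_def)
  have T': "norm (snd \<tau>) = 1" "dist (fst \<tau>) d \<le> l" "K \<le> card (B \<tau>)" if "\<tau> \<in> T" for \<tau>
    using T(2) that by (auto simp: tubes_def B_def)
  have cardJ: "K \<le> card (J \<tau>)" if \<tau>: "\<tau> \<in> T" for \<tau>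
  proof -
    have "inj_on (cell \<tau>) (B \<tau>)"
    proof (rule inj_onI, rule ccontr)
      fix i j assume ij: "i \<in> B \<tau>" "j \<in> B \<tau>" "cell \<tau> i = cell \<tau> j" "i \<noteq> j"
      have "dist (s \<tau> i) (s \<tau> j) \<le> \<rho> / 6 + \<rho> / 6"
        by (rule dist_triangle_le[of _ "cell \<tau> i"]) (use cell[OF ij(1)] cell[OF ij(2)] ij(3) in \<open>simp add: dist_commute\<close>)
      moreover have "dist (s \<tau> i) (s \<tau> j) = \<bar>real i - real j\<bar> * \<rho>"
        unfolding s_def dist_line[OF T'(1)[OF \<tau>]] using rho_pos by (simp add: left_diff_distrib[symmetric] abs_mult)
      moreover have "1 * \<rho> \<le> \<bar>real i - real j\<bar> * \<rho>"
        using ij(4) rho_pos by (intro mult_right_mono) auto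
      ultimately show False using rho_pos by simp
    qed
    then show ?thesis using T'(3)[OF \<tau>] by (simp add: J_def card_image)
  qed
  define Cand where "Cand c = {p \<in> (+) c ` G. \<forall>z\<in>Z. 1/2 \<le> dist p z}" for c
  define hit where "hit \<tau> p \<longleftrightarrow> (\<exists>t\<in>{0..l}. dist (fst \<tau> + t *\<^sub>R snd \<tau>) p \<le> \<epsilon> / 2)" for \<tau> :: "'a \<times> 'a" and p
  have hits: "\<exists>p\<in>Cand c. hit \<tau> p" if \<tau>: "\<tau> \<in> T" and c: "c \<in> J \<tau>" for \<tau> c
  proof -
    obtain j where j: "j \<in> B \<tau>" "c = cell \<tau> j" using c by (auto simp: J_def)
    obtain t where t: "t \<in> {0..L}" "\<forall>z\<in>Z. 1 \<le> dist (s \<tau> j + t *\<^sub>R snd \<tau>) z"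
      using Z T'(1)[OF \<tau>] unfolding porous_def by blast
    define w where "w = s \<tau> j + t *\<^sub>R snd \<tau>"
    have "dist w (s \<tau> j) \<le> L" using t T'(1)[OF \<tau>] by (simp add: w_def dist_norm)
    \<comment> \<open>Since \<open>\<rho> / 6 = L + 2\<close>, a walk of length at most
      \<open>L\<close> from a sample within \<open>\<rho> / 6\<close> of \<open>c\<close> stays in
      the cell.\<close>
    then have "dist w c \<le> \<rho> / 3" using cell[OF j(1)] j(2) dist_triangle[of w c "s \<tau> j"] rho by simp
    then have "w - c \<in> cball 0 (\<rho> / 3)" by (simp add: dist_norm norm_minus_commute)
    then have "w - c \<in> (\<Union>g\<in>G. cball g (\<epsilon> / 2))" using G(3) by blast
    then obtain g where g: "g \<in> G" "dist g (w - c) \<le> \<epsilon> / 2" by auto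
    have wc: "dist w (c + g) \<le> \<epsilon> / 2" using g(2) by (simp add: dist_norm norm_minus_commute algebra_simps)
    \<comment> \<open>The free distance 1 drops to 1/2 to pay for rounding \<open>w\<close> to a
      candidate, which costs at most \<open>\<epsilon> / 2\<close> \<le> 1/4.\<close>
    have "1/2 \<le> dist (c + g) z" if "z \<in> Z" for z
    proof -
      have "1 \<le> dist w z" using t that by (simp add: w_def)
      then show ?thesis using wc dist_triangle[of w z "c + g"] eps by simp
    qed
    then have "c + g \<in> Cand c" using g by (auto simp: Cand_def)
    moreover have "hit \<tau> (c + g)"
    proof -
      \<comment> \<open>Sample indices stop at \<open>M - 1\<close>, so the free position after the
        sample still lies on the segment of length \<open>l\<close>.\<close>
      have "real j + 1 \<le> real M" using ltM[OF j(1)] by simp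
      then have "(real j + 1) * \<rho> \<le> l" unfolding l using rho_pos by (intro mult_right_mono) auto
      then have "real j * \<rho> + t \<in> {0..l}" using t rho L by (auto simp: algebra_simps)
      moreover have "w = fst \<tau> + (real j * \<rho> + t) *\<^sub>R snd \<tau>" by (simp add: w_def s_def algebra_simps)
      ultimately show ?thesis using wc unfolding hit_def by auto
    qed
    ultimately show ?thesis by blast
  qed
  define r where "r = 1 - 1 / real (card G + 1)"
  have r: "0 \<le> r" "r \<le> 1" by (auto simp: r_def)
  have "(\<Sum>\<tau>\<in>T. r ^ card (J \<tau> \<inter> I)) \<le> (\<Sum>\<tau>\<in>T. r ^ K)"
  proof (rule sum_mono)
    fix \<tau> assume \<tau>: "\<tau> \<in> T"
    then have "J \<tau> \<inter> I = J \<tau>" by (auto simp: I_def)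
    then show "r ^ card (J \<tau> \<inter> I) \<le> r ^ K" using cardJ[OF \<tau>] r by (simp add: power_decreasing)
  qed
  also have "\<dots> = real (card T) * r ^ K" by simp
  also have "\<dots> \<le> real (card N ^ 2) * r ^ K"
    using T(3) r by (intro mult_right_mono) (auto simp flip: of_nat_power)
  also have "\<dots> < 1" using few by (simp add: r_def)
  finally have sum: "(\<Sum>\<tau>\<in>T. (1 - 1 / real (card G + 1)) ^ card (J \<tau> \<inter> I)) < 1" by (simp add: r_def)
  have "\<exists>\<phi>. (\<forall>c\<in>I. \<phi> c \<in> Cand c) \<and> (\<forall>\<tau>\<in>T. \<exists>c\<in>I. hit \<tau> (\<phi> c))"
  proof (rule greedy_hitting[OF _ T(1) _ _ _ sum])
    show "finite I" using T(1) finB by (auto simp: I_def J_def)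
    show "finite (Cand c) \<and> Cand c \<noteq> {} \<and> card (Cand c) \<le> card G + 1" if "c \<in> I" for c
    proof -
      have sub: "Cand c \<subseteq> (+) c ` G" by (auto simp: Cand_def)
      then have "card (Cand c) \<le> card ((+) c ` G)" by (rule card_mono[rotated]) (use G in auto)
      also have "\<dots> \<le> card G" by (rule card_image_le) (use G in auto)
      finally have "card (Cand c) \<le> card G + 1" by simp
      moreover have "finite (Cand c)" using sub G by (auto intro: finite_subset)
      moreover have "Cand c \<noteq> {}" using hits that by (auto simp: I_def)
      ultimately show ?thesis by blast
    qed
  qed (use hits in auto)
  then obtain \<phi> where \<phi>: "\<And>c. c \<in> I \<Longrightarrow> \<phi> c \<in> Cand c" "\<And>\<tau>. \<tau> \<in> T \<Longrightarrow> \<exists>c\<in>I. hit \<tau> (\<phi> c)" by blast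
  show ?thesis
  proof (intro exI conjI ballI)
    show "I \<subseteq> C" using cell by (auto simp: I_def J_def)
    fix c assume c: "c \<in> I"
    \<comment> \<open>At most \<open>l\<close> from \<open>d\<close> to the start of the tube,
      \<open>l\<close> on to the sample, and \<open>\<rho> / 6\<close> to the centre of the
      cell.\<close>
    show "dist c d < 3 * l"
    proof -
      obtain \<tau> j where \<tau>: "\<tau> \<in> T" "j \<in> B \<tau>" "c = cell \<tau> j" using c by (auto simp: I_def J_def)
      have "real j * \<rho> \<le> l" unfolding l using ltM[OF \<tau>(2)] rho_pos by (intro mult_right_mono) auto
      then have "dist (s \<tau> j) (fst \<tau>) \<le> l" using T'(1)[OF \<tau>(1)] rho_pos by (simp add: s_def dist_norm)
      then have "dist (s \<tau> j) d \<le> 2 * l" using T'(2)[OF \<tau>(1)] dist_triangle[of "s \<tau> j" d "fst \<tau>"] by simp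
      then show ?thesis
        using cell[OF \<tau>(2)] \<tau>(3) dist_triangle[of c d "s \<tau> j"] rho_le_l rho_pos by (simp add: dist_commute)
    qed
    show "dist c (\<phi> c) \<le> \<rho> / 3" using \<phi>(1)[OF c] G(2) by (auto simp: Cand_def dist_norm)
    show "1/2 \<le> dist (\<phi> c) z" if "z \<in> Z" for z using \<phi>(1)[OF c] that by (auto simp: Cand_def)
  next
    fix \<tau> assume "\<tau> \<in> tubes d"
    moreover obtain x v where xv: "\<tau> = (x, v)" by fastforce
    ultimately obtain x' v' where x'v': "(x', v') \<in> T" "\<forall>t\<in>{0..l}. dist (x + t *\<^sub>R v) (x' + t *\<^sub>R v') \<le> \<epsilon> / 2"
      using T(4) by blast
    then obtain c t where ct: "c \<in> I" "t \<in> {0..l}" "dist (x' + t *\<^sub>R v') (\<phi> c) \<le> \<epsilon> / 2"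
      using \<phi>(2)[of "(x', v')"] by (auto simp: hit_def)
    then have "dist (x + t *\<^sub>R v) (\<phi> c) \<le> \<epsilon>"
      using x'v'(2) dist_triangle[of "x + t *\<^sub>R v" "\<phi> c" "x' + t *\<^sub>R v'"] by force
    with ct show "case \<tau> of (x, v) \<Rightarrow> \<exists>t\<in>{0..l}. \<exists>c\<in>I. dist (x + t *\<^sub>R v) (\<phi> c) \<le> \<epsilon>"
      by (auto simp: xv)
  qed
qed

text \<open>Points of \<open>D\<close> are \<open>6 * l\<close> apart and use cells within
  \<open>3 * l\<close>, so they never compete for a cell and the local choices combine freely.
  Points from different cells are at least \<open>\<rho> - 2 * (\<rho> / 3) = 2 * L + 4\<close>
  apart, which explains \<open>\<rho> = 6 * (L + 2)\<close>.\<close>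

lemma global_choice:
  assumes D: "separated (6 * l) D"
  shows "\<exists>Y. separated (2 * L + 4) Y \<and> (\<forall>y\<in>Y. \<forall>z\<in>Z. 1/2 \<le> dist y z) \<and>
     (\<forall>d\<in>D. \<forall>(x, v)\<in>tubes d. \<exists>t\<in>{0..l}. \<exists>y\<in>Y. dist (x + t *\<^sub>R v) y \<le> \<epsilon>)"
proof -
  define P where "P d \<phi> I \<longleftrightarrow> I \<subseteq> C \<and>
      (\<forall>c\<in>I. dist c d < 3 * l \<and> dist c (\<phi> c) \<le> \<rho> / 3 \<and> (\<forall>z\<in>Z. 1/2 \<le> dist (\<phi> c) z)) \<and>
      (\<forall>(x, v)\<in>tubes d. \<exists>t\<in>{0..l}. \<exists>c\<in>I. dist (x + t *\<^sub>R v) (\<phi> c) \<le> \<epsilon>)" for d \<phi> I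
  have "\<exists>\<phi>I. P d (fst \<phi>I) (snd \<phi>I)" for d
    using local_choice[of d] unfolding P_def by simp
  then obtain F where F: "\<And>d. P d (fst (F d)) (snd (F d))" by metis
  define \<phi> where "\<phi> d = fst (F d)" for d
  define I where "I d = snd (F d)" for d
  have P: "P d (\<phi> d) (I d)" for d using F by (simp add: \<phi>_def I_def)
  have I: "\<And>d. I d \<subseteq> C"
    "\<And>d c. c \<in> I d \<Longrightarrow> dist c d < 3 * l \<and> dist c (\<phi> d c) \<le> \<rho> / 3 \<and> (\<forall>z\<in>Z. 1/2 \<le> dist (\<phi> d c) z)"
    "\<And>d. \<forall>(x, v)\<in>tubes d. \<exists>t\<in>{0..l}. \<exists>c\<in>I d. dist (x + t *\<^sub>R v) (\<phi> d c) \<le> \<epsilon>"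
    using P unfolding P_def by blast+
  define Y where "Y = (\<Union>d\<in>D. \<phi> d ` I d)"
  have "separated (2 * L + 4) Y"
    unfolding separated_def
  proof (intro ballI impI)
    fix y z assume "y \<in> Y" "z \<in> Y" "y \<noteq> z"
    then obtain d c d' c' where h: "d \<in> D" "c \<in> I d" "y = \<phi> d c" "d' \<in> D" "c' \<in> I d'" "z = \<phi> d' c'"
      by (auto simp: Y_def)
    have "c \<noteq> c'"
    proof
      assume "c = c'"
      then have "dist d d' < 6 * l"
        using I(2)[OF h(2)] I(2)[OF h(5)] dist_triangle[of d d' c] by (simp add: dist_commute)
      then have "d = d'" using D h by (force simp: separated_def)
      then show False using \<open>c = c'\<close> h \<open>y \<noteq> z\<close> by simp
    qed
    then have "\<rho> \<le> dist c c'" using C I(1) h by (force simp: separated_def)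
    moreover have "dist c y \<le> \<rho> / 3" "dist c' z \<le> \<rho> / 3" using I(2) h by auto
    ultimately have "\<rho> / 3 \<le> dist y z"
      using dist_triangle[of c c' y] dist_triangle[of y c' z] by (simp add: dist_commute)
    then show "2 * L + 4 \<le> dist y z" using rho by simp
  qed
  moreover have "\<forall>y\<in>Y. \<forall>z\<in>Z. 1/2 \<le> dist y z" using I(2) by (auto simp: Y_def)
  moreover have "\<forall>d\<in>D. \<forall>(x, v)\<in>tubes d. \<exists>t\<in>{0..l}. \<exists>y\<in>Y. dist (x + t *\<^sub>R v) y \<le> \<epsilon>"
    using I(3) unfolding Y_def by fast
  ultimately show ?thesis by blast
qed

end

subsection \<open>Existence of uniformly discrete dense forests\<close>

text \<open>There are \<open>q\<close> translates of the lattice of cells and \<open>q\<close> translates of the lattice of large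
  balls, hence \<open>m = q * q\<close> requirements. A segment of length \<open>q K \<rho>\<close> starts in a ball of some translate
  and by pigeonhole meets the cores of at least \<open>K\<close> cells of some translate.\<close>

lemma stage_requirements:
  "\<exists>m::nat. 0 < m \<and> (\<forall>\<epsilon> L. 0 < \<epsilon> \<and> \<epsilon> \<le> 1/2 \<and> 0 \<le> L \<longrightarrow>
     (\<exists>(Q :: nat \<Rightarrow> 'a::euclidean_space set \<Rightarrow> bool) l. 0 < l \<and> (\<forall>i<m. achievable L (Q i)) \<and>
       (\<forall>i Y Y'. Q i Y \<longrightarrow> Y \<subseteq> Y' \<longrightarrow> Q i Y') \<and>
       (\<forall>Y. (\<forall>i<m. Q i Y) \<longrightarrow>
         (\<forall>x v. norm v = 1 \<longrightarrow> (\<exists>t\<in>{0..l}. \<exists>y\<in>Y. dist (x + t *\<^sub>R v) y \<le> \<epsilon>)))))"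
proof -
  obtain q and \<Lambda> :: "nat \<Rightarrow> 'a set" where \<Lambda>: "\<And>i. i < q \<Longrightarrow> separated 1 (\<Lambda> i)"
    "\<And>x. \<exists>i<q. \<exists>y\<in>\<Lambda> i. dist x y \<le> 1/6"
    using separated_lattice_cover[where 'a='a] by blast
  have q: "0 < q" using \<Lambda>(2)[of 0] by auto
  obtain A where A: "\<And>n r. 0 < r \<Longrightarrow> \<exists>N. finite N \<and> card N \<le> A ^ n \<and>
     cball (0::'a) (2 ^ n * r) \<subseteq> (\<Union>y\<in>N. cball y r)"
    using doubling_cover[where 'a='a] by blast
  have scaled: "separated s ((*\<^sub>R) s ` \<Lambda> i)" if "i < q" "0 < s" for i s
    unfolding separated_def
  proof (intro ballI impI)
    fix y z assume "y \<in> (*\<^sub>R) s ` \<Lambda> i" "z \<in> (*\<^sub>R) s ` \<Lambda> i" "y \<noteq> z"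
    then obtain y' z' where h: "y = s *\<^sub>R y'" "z = s *\<^sub>R z'" "y' \<in> \<Lambda> i" "z' \<in> \<Lambda> i" "y' \<noteq> z'" by auto
    then have "1 \<le> dist y' z'" using \<Lambda>(1)[OF that(1)] by (auto simp: separated_def)
    moreover have "dist y z = s * dist y' z'"
      using h that(2) by (simp add: dist_norm scaleR_diff_right[symmetric])
    ultimately show "s \<le> dist y z" using that(2) by simp
  qed
  have scaled_cover: "\<exists>i<q. \<exists>y\<in>(*\<^sub>R) s ` \<Lambda> i. dist x y \<le> s / 6" if "0 < s" for s x
  proof -
    obtain i y where y: "i < q" "y \<in> \<Lambda> i" "dist ((1 / s) *\<^sub>R x) y \<le> 1/6" using \<Lambda>(2) by blast
    have "x - s *\<^sub>R y = s *\<^sub>R ((1 / s) *\<^sub>R x - y)" using that by (simp add: algebra_simps)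
    then have "dist x (s *\<^sub>R y) = s * dist ((1 / s) *\<^sub>R x) y" using that by (simp add: dist_norm)
    also have "\<dots> \<le> s * (1/6)" using y that by (intro mult_left_mono) auto
    finally show ?thesis using y by (intro exI[of _ i]) auto
  qed
  have "\<exists>(Q :: nat \<Rightarrow> 'a set \<Rightarrow> bool) l. 0 < l \<and> (\<forall>i<q * q. achievable L (Q i)) \<and>
       (\<forall>i Y Y'. Q i Y \<longrightarrow> Y \<subseteq> Y' \<longrightarrow> Q i Y') \<and>
       (\<forall>Y. (\<forall>i<q * q. Q i Y) \<longrightarrow>
         (\<forall>x v. norm v = 1 \<longrightarrow> (\<exists>t\<in>{0..l}. \<exists>y\<in>Y. dist (x + t *\<^sub>R v) y \<le> \<epsilon>)))"
    if eps: "0 < \<epsilon>" "\<epsilon> \<le> 1/2" and L: "0 \<le> L" for \<epsilon> L :: real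
  proof -
    define \<rho> where "\<rho> = 6 * (L + 2)"
    have rho: "0 < \<rho>" using L by (simp add: \<rho>_def)
    have "\<exists>G. finite G \<and> G \<subseteq> cball (0::'a) (\<rho> / 3) \<and> cball 0 (\<rho> / 3) \<subseteq> (\<Union>g\<in>G. ball g (\<epsilon> / 2))"
      using seq_compact_imp_totally_bounded[of "cball (0::'a) (\<rho> / 3)"] compact_cball eps(1)
      by (simp add: compact_eq_seq_compact_metric[symmetric])
    then obtain G where G: "finite G" "G \<subseteq> cball (0::'a) (\<rho> / 3)" "cball 0 (\<rho> / 3) \<subseteq> (\<Union>g\<in>G. ball g (\<epsilon> / 2))"
      by blast
    have "ball g (\<epsilon> / 2) \<subseteq> cball g (\<epsilon> / 2)" for g :: 'a by (rule ball_subset_cball)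
    with G(3) have G3: "cball 0 (\<rho> / 3) \<subseteq> (\<Union>g\<in>G. cball g (\<epsilon> / 2))" by blast
    \<comment> \<open>The summand 1 keeps \<open>r\<close> positive even if \<open>G\<close> is a
      singleton, as \<open>double_exponential_wins\<close> takes its logarithm.\<close>
    define r where "r = 1 - 1 / real (card G + 1)"
    have "G \<noteq> {}"
    proof
      assume "G = {}"
      with G(3) rho show False by auto
    qed
    then have r: "0 < r" "r < 1" using G(1) by (auto simp: r_def field_simps card_gt_0_iff)
    \<comment> \<open>\<open>k\<close> can be fixed before \<open>n\<close>: the ratio of
      \<open>2 * l\<close> to the net radius \<open>\<epsilon> / 4\<close> will be
      \<open>2 ^ n\<close> times this constant, whatever \<open>n\<close> turns out to be.\<close>
    obtain k where k: "8 * (real q * \<rho> / \<epsilon>) < 2 ^ k"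
      using real_arch_pow[of 2 "8 * (real q * \<rho> / \<epsilon>)"] by auto
    obtain n where n: "real (A ^ (n + k)) ^ 2 * r ^ (2 ^ n) < 1"
      using double_exponential_wins[OF r] by blast
    define K :: nat where "K = 2 ^ n"
    define M where "M = q * K"
    define l where "l = real M * \<rho>"
    have M: "0 < M" using q by (simp add: M_def K_def)
    then have lpos: "0 < l" using rho by (simp add: l_def)
    obtain N where N: "finite N" "card N \<le> A ^ (n + k)"
      "cball (0::'a) (2 ^ (n + k) * (\<epsilon> / 4)) \<subseteq> (\<Union>y\<in>N. cball y (\<epsilon> / 4))"
      using A[of "\<epsilon> / 4" "n + k"] eps by auto
    have "2 * l \<le> 2 ^ (n + k) * (\<epsilon> / 4)"
    proof -
      have "2 * l = 2 ^ n * (8 * (real q * \<rho> / \<epsilon>)) * (\<epsilon> / 4)"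
        using eps by (simp add: l_def M_def K_def)
      also have "\<dots> \<le> 2 ^ n * 2 ^ k * (\<epsilon> / 4)"
        using k eps by (intro mult_right_mono mult_left_mono) auto
      finally show ?thesis by (simp add: power_add)
    qed
    then have N3: "cball (0::'a) (2 * l) \<subseteq> (\<Union>y\<in>N. cball y (\<epsilon> / 4))"
      using N(3) subset_cball[of "2 * l" "2 ^ (n + k) * (\<epsilon> / 4)" "0::'a"] by blast
    have "real (card N) ^ 2 * r ^ K \<le> real (A ^ (n + k)) ^ 2 * r ^ K"
      using N(2) r by (intro mult_right_mono power_mono) (auto simp del: of_nat_power)
    with n have few: "real (card N) ^ 2 * (1 - 1 / real (card G + 1)) ^ K < 1"
      by (simp add: r_def K_def)
    \<comment> \<open>The index \<open>i\<close> encodes a pair: \<open>i mod q\<close> selects the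
      lattice of cells, \<open>i div q\<close> that of the ball centres.\<close>
    define C where "C i = (*\<^sub>R) \<rho> ` \<Lambda> (i mod q)" for i
    define D where "D i = (*\<^sub>R) (6 * l) ` \<Lambda> (i div q)" for i
    define Q where "Q i Y \<longleftrightarrow> (\<forall>d\<in>D i. \<forall>x v. norm v = 1 \<and> dist x d \<le> l \<and> K \<le> card (cells_met \<rho> (C i) M x v)
        \<longrightarrow> (\<exists>t\<in>{0..l}. \<exists>y\<in>Y. dist (x + t *\<^sub>R v) y \<le> \<epsilon>))" for i Y
    have C: "separated \<rho> (C i)" for i unfolding C_def by (rule scaled) (use q rho in auto)
    have "achievable L (Q i)" if i: "i < q * q" for i
      unfolding achievable_def
    proof (intro allI impI)
      fix Z :: "'a set" assume Z: "porous L Z"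
      interpret cell_setup L \<epsilon> \<rho> l "C i" M K G N Z
        by (intro cell_setup.intro L eps \<rho>_def M l_def C G(1,2) G3 N(1) N3 few Z)
      have "i div q < q" using i by (simp add: less_mult_imp_div_less)
      then have "separated (6 * l) (D i)" unfolding D_def by (rule scaled) (use lpos in simp)
      then show "\<exists>Y. separated (2 * L + 4) Y \<and> (\<forall>y\<in>Y. \<forall>z\<in>Z. 1/2 \<le> dist y z) \<and> Q i Y"
        using global_choice unfolding Q_def tubes_def by simp
    qed
    moreover have "\<exists>t\<in>{0..l}. \<exists>y\<in>Y. dist (x + t *\<^sub>R v) y \<le> \<epsilon>"
      if Y: "\<forall>i<q * q. Q i Y" and v: "norm v = 1" for Y and x v :: 'a
    proof -
      have "{..<M} \<subseteq> (\<Union>f\<in>{..<q}. cells_met \<rho> (C f) M x v)"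
      proof
        fix j assume "j \<in> {..<M}"
        then show "j \<in> (\<Union>f\<in>{..<q}. cells_met \<rho> (C f) M x v)"
          using scaled_cover[OF rho, of "x + (real j * \<rho>) *\<^sub>R v"] by (auto simp: cells_met_def C_def)
      qed
      then have "M \<le> card (\<Union>f\<in>{..<q}. cells_met \<rho> (C f) M x v)"
        using card_mono[of "\<Union>f\<in>{..<q}. cells_met \<rho> (C f) M x v" "{..<M}"] by (auto simp: cells_met_def)
      also have "\<dots> \<le> (\<Sum>f<q. card (cells_met \<rho> (C f) M x v))"
        by (rule card_UN_le) simp
      finally have big: "q * K \<le> (\<Sum>f<q. card (cells_met \<rho> (C f) M x v))" by (simp add: M_def)
      have "\<exists>f<q. K \<le> card (cells_met \<rho> (C f) M x v)"
      proof (rule ccontr)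
        assume "\<not> ?thesis"
        then have "(\<Sum>f<q. card (cells_met \<rho> (C f) M x v)) < (\<Sum>f<q. K)"
          by (intro sum_strict_mono) (use q in auto)
        with big show False by simp
      qed
      then obtain f where f: "f < q" "K \<le> card (cells_met \<rho> (C f) M x v)" by blast
      obtain g d where g: "g < q" "d \<in> (*\<^sub>R) (6 * l) ` \<Lambda> g" "dist x d \<le> l"
        using scaled_cover[of "6 * l" x] lpos by auto
      define i where "i = g * q + f"
      have "g * q + f < (g + 1) * q" using f by simp
      also have "\<dots> \<le> q * q" using g by (intro mult_le_mono1) simp
      finally have i: "i < q * q" by (simp add: i_def)
      have "i div q = g" "i mod q = f" using f by (auto simp: i_def)
      then have "d \<in> D i" "C i = C f" using g f by (auto simp: D_def C_def)
      then show ?thesis using Y i f g v by (auto simp: Q_def)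
    qed
    moreover have "\<forall>i Y Y'. Q i Y \<longrightarrow> Y \<subseteq> Y' \<longrightarrow> Q i Y'" unfolding Q_def by blast
    ultimately show ?thesis using lpos by blast
  qed
  then show ?thesis using q by (intro exI[of _ "q * q"]) simp
qed

lemma setdist_segment_le:
  fixes Y :: "'a::euclidean_space set"
  assumes "y \<in> Y" "0 \<le> t" "t \<le> T" "dist (x + t *\<^sub>R v) y \<le> e"
  shows "setdist Y (closed_segment x (x + T *\<^sub>R v)) \<le> e"
proof -
  have "x + t *\<^sub>R v \<in> closed_segment x (x + T *\<^sub>R v)"
  proof (cases "T = 0")
    case True
    then show ?thesis using assms by simp
  next
    case False
    have "x + t *\<^sub>R v = (1 - t / T) *\<^sub>R x + (t / T) *\<^sub>R (x + T *\<^sub>R v)"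
      using False by (simp add: algebra_simps)
    then show ?thesis unfolding in_segment using assms False by (intro exI[of _ "t / T"]) auto
  qed
  then have "setdist Y (closed_segment x (x + T *\<^sub>R v)) \<le> dist y (x + t *\<^sub>R v)"
    using assms by (intro setdist_le_dist)
  then show ?thesis using assms by (simp add: dist_commute)
qed

text \<open>A visibility function is obtained as a supremum over all segments; the instance \<open>\<epsilon> = 1\<close> of
  the hypothesis makes that supremum finite.\<close>

lemma dense_forestI:
  fixes Y :: "'a::euclidean_space set"
  assumes hit: "\<And>\<epsilon>. 0 < \<epsilon> \<Longrightarrow> \<exists>l. \<forall>x v. norm v = 1 \<longrightarrow> (\<exists>t\<in>{0..l}. \<exists>y\<in>Y. dist (x + t *\<^sub>R v) y \<le> \<epsilon>)"
  shows "dense_forest Y"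
proof -
  define s where "s T = (\<lambda>(x::'a, v::'a). setdist Y (closed_segment x (x + T *\<^sub>R v)))" for T
  define e where "e T = Sup (s T ` (UNIV \<times> {v. norm v = 1}))" for T
  obtain b where b: "b \<in> (Basis :: 'a set)" using nonempty_Basis by blast
  then have ne: "(UNIV :: 'a set) \<times> {v::'a. norm v = 1} \<noteq> {}" by (auto intro!: exI[of _ b])
  obtain l1 where l1: "\<And>(x::'a) v. norm v = 1 \<Longrightarrow> \<exists>t\<in>{0..l1}. \<exists>y\<in>Y. dist (x + t *\<^sub>R v) y \<le> 1"
    using hit[of 1] by auto
  \<comment> \<open>Measured from the starting point alone, so the bound holds for every
    \<open>T > 0\<close>, however short the segment.\<close>
  have s_le: "s T (x, v) \<le> l1 + 1" if "0 < T" "norm v = 1" for T x v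
  proof -
    obtain t y where t: "t \<in> {0..l1}" "y \<in> Y" "dist (x + t *\<^sub>R v) y \<le> 1" using l1[OF \<open>norm v = 1\<close>] by blast
    then have "dist x y \<le> l1 + 1"
      using dist_triangle[of x y "x + t *\<^sub>R v"] that by (auto simp: dist_norm)
    then show ?thesis unfolding s_def using setdist_segment_le[OF t(2), of 0 T x v "l1 + 1"] that by simp
  qed
  have bdd: "bdd_above (s T ` (UNIV \<times> {v. norm v = 1}))" if "0 < T" for T
    by (rule bdd_aboveI[of _ "l1 + 1"]) (use s_le[OF that] in auto)
  have s_le_e: "s T (x, v) \<le> e T" if "0 < T" "norm v = 1" for T x v
    unfolding e_def by (rule cSUP_upper[OF _ bdd]) (use that in auto)
  have "(e \<longlongrightarrow> 0) at_top"
  proof (rule tendstoI)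
    fix \<epsilon> :: real assume "0 < \<epsilon>"
    then obtain l where l: "\<And>(x::'a) v. norm v = 1 \<Longrightarrow> \<exists>t\<in>{0..l}. \<exists>y\<in>Y. dist (x + t *\<^sub>R v) y \<le> \<epsilon> / 2"
      using hit[of "\<epsilon> / 2"] by auto
    have "dist (e T) 0 < \<epsilon>" if T: "max 1 l \<le> T" for T
    proof -
      have "e T \<le> \<epsilon> / 2"
        unfolding e_def
      proof (rule cSUP_least[OF ne])
        fix p assume p: "p \<in> (UNIV :: 'a set) \<times> {v :: 'a. norm v = 1}"
        obtain x v where xv: "p = (x, v)" by fastforce
        obtain t y where t: "t \<in> {0..l}" "y \<in> Y" "dist (x + t *\<^sub>R v) y \<le> \<epsilon> / 2"
          using l[of v x] p xv by blast
        then show "s T p \<le> \<epsilon> / 2" unfolding xv s_def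
          using setdist_segment_le[OF t(2), of t T x v "\<epsilon> / 2"] T by simp
      qed
      moreover have "0 \<le> s T (0, b)" by (simp add: s_def setdist_pos_le)
      then have "0 \<le> e T" using s_le_e[of T b 0] T b by (simp add: order_trans)
      ultimately show ?thesis using \<open>0 < \<epsilon>\<close> by simp
    qed
    then show "eventually (\<lambda>T. dist (e T) 0 < \<epsilon>) at_top"
      unfolding eventually_at_top_linorder by blast
  qed
  moreover have "Y \<noteq> {}" using l1[of b 0] b by auto
  ultimately show ?thesis
    unfolding dense_forest_def using s_le_e by (auto simp: s_def)
qed

text \<open>Requirement \<open>k\<close> is number \<open>k mod m\<close> of stage
  \<open>k div m\<close>, so a stage occupies \<open>m\<close> consecutive steps. Stage
  \<open>n\<close> is built for \<open>L (Suc n * m)\<close>, the bound just after its block, which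
  dominates all bounds within it.\<close>

theorem uniform_discrete_dense_forest_exists:
  "\<exists>Y :: 'a::euclidean_space set. uniform_discrete Y \<and> dense_forest Y"
proof -
  obtain m where m: "0 < m" and stage: "\<forall>\<epsilon> L. 0 < \<epsilon> \<and> \<epsilon> \<le> 1/2 \<and> 0 \<le> L \<longrightarrow>
     (\<exists>(Q :: nat \<Rightarrow> 'a set \<Rightarrow> bool) l. 0 < l \<and> (\<forall>i<m. achievable L (Q i)) \<and>
       (\<forall>i Y Y'. Q i Y \<longrightarrow> Y \<subseteq> Y' \<longrightarrow> Q i Y') \<and>
       (\<forall>Y. (\<forall>i<m. Q i Y) \<longrightarrow>
         (\<forall>x v. norm v = 1 \<longrightarrow> (\<exists>t\<in>{0..l}. \<exists>y\<in>Y. dist (x + t *\<^sub>R v) y \<le> \<epsilon>))))"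
    using stage_requirements[where 'a='a] by (elim exE conjE) (rule that)
  define L :: "nat \<Rightarrow> real" where "L = rec_nat 0 (\<lambda>k l. 2 * l + 2)"
  have L: "L 0 = 0" "L (Suc k) = 2 * L k + 2" for k by (simp_all add: L_def)
  have L0: "0 \<le> L k" for k by (induction k) (simp_all add: L)
  have Lmono: "i \<le> j \<Longrightarrow> L i \<le> L j" for i j
    by (rule lift_Suc_mono_le[of L]) (use L0 in \<open>auto simp: L intro: add_nonneg_nonneg\<close>)
  \<comment> \<open>The shift by 2 respects the upper bound 1/2 on the precision of a stage.\<close>
  define \<epsilon> where "\<epsilon> n = 1 / real (n + 2)" for n
  define good where "good n Q l \<longleftrightarrow> 0 < l \<and> (\<forall>i<m. achievable (L (Suc n * m)) (Q i)) \<and>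
       (\<forall>i Y Y'. Q i Y \<longrightarrow> Y \<subseteq> Y' \<longrightarrow> Q i Y') \<and>
       (\<forall>Y. (\<forall>i<m. Q i Y) \<longrightarrow>
         (\<forall>x v. norm v = 1 \<longrightarrow> (\<exists>t\<in>{0..l}. \<exists>y\<in>Y. dist (x + t *\<^sub>R v) y \<le> \<epsilon> n)))"
    for n l and Q :: "nat \<Rightarrow> 'a set \<Rightarrow> bool"
  have "\<exists>Ql. good n (fst Ql) (snd Ql)" for n
    using stage[rule_format, of "\<epsilon> n" "L (Suc n * m)"] L0 unfolding good_def \<epsilon>_def by (simp add: divide_simps)
  then obtain F where F: "\<And>n. good n (fst (F n)) (snd (F n))" by metis
  define Q where "Q n = fst (F n)" for n
  define l where "l n = snd (F n)" for n
  have Q: "good n (Q n) (l n)" for n using F by (simp add: Q_def l_def)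
  have "\<exists>Y. separated (1/2) Y \<and> (\<forall>k. Q (k div m) (k mod m) Y)"
  proof (rule achieve_sequence[of L])
    fix k
    have "k \<le> Suc (k div m) * m"
      using dividend_less_div_times[OF m, of k] by simp
    moreover have "achievable (L (Suc (k div m) * m)) (Q (k div m) (k mod m))"
      using Q[of "k div m"] m unfolding good_def by simp
    ultimately show "achievable (L k) (Q (k div m) (k mod m))"
      using Lmono achievable_antimono by blast
  next
    show "Q (k div m) (k mod m) Y'" if "Q (k div m) (k mod m) Y" "Y \<subseteq> Y'" for k Y Y'
      using Q[of "k div m"] that unfolding good_def by blast
  qed (use L in auto)
  then obtain Y where Y: "separated (1/2) Y" "\<And>k. Q (k div m) (k mod m) Y" by blast
  have YQ: "Q n i Y" if "i < m" for n i
    using Y(2)[of "n * m + i"] that by simp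
  have "dense_forest Y"
  proof (rule dense_forestI)
    fix e :: real assume "0 < e"
    then obtain n where n: "inverse (real (Suc n)) < e" using reals_Archimedean by blast
    have "\<epsilon> n \<le> inverse (real (Suc n))" by (simp add: \<epsilon>_def divide_simps)
    then have "\<epsilon> n \<le> e" using n by simp
    then show "\<exists>l. \<forall>x v. norm v = 1 \<longrightarrow> (\<exists>t\<in>{0..l}. \<exists>y\<in>Y. dist (x + t *\<^sub>R v) y \<le> e)"
      using Q[of n] YQ[of _ n] unfolding good_def by (meson order_trans)
  qed
  moreover have "uniform_discrete Y"
    using Y(1) unfolding separated_def uniform_discrete_def by (intro exI[of _ "1/2"]) force
  ultimately show ?thesis by blast
qed

subsection \<open>Weak compactness of probability measures on a compact metric space\<close>

lemma ternary_bounds: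
  fixes a :: "nat \<Rightarrow> real"
  assumes "range a \<subseteq> {0, 1}"
  shows "summable (\<lambda>k. a k * (1/3) ^ k)" "0 \<le> (\<Sum>k. a k * (1/3) ^ k)" "(\<Sum>k. a k * (1/3) ^ k) \<le> 3/2"
proof -
  have a: "0 \<le> a k" "a k \<le> 1" for k using assms by (auto simp: image_subset_iff dest: spec[of _ k])
  have g: "summable (\<lambda>k. (1/3 :: real) ^ k)" by (simp add: summable_geometric)
  show s: "summable (\<lambda>k. a k * (1/3) ^ k)"
    by (rule summable_comparison_test'[OF g, of 0]) (use a in \<open>simp add: abs_mult mult_left_le_one_le\<close>)
  show "0 \<le> (\<Sum>k. a k * (1/3) ^ k)" by (rule suminf_nonneg[OF s]) (use a in simp)
  have "(\<Sum>k. a k * (1/3) ^ k) \<le> (\<Sum>k. (1/3) ^ k)"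
    by (rule suminf_le[OF _ s g]) (use a in \<open>simp add: mult_left_le_one_le\<close>)
  also have "\<dots> = 3/2" by (subst suminf_geometric) auto
  finally show "(\<Sum>k. a k * (1/3) ^ k) \<le> 3/2" .
qed

lemma ternary_split_head:
  fixes a :: "nat \<Rightarrow> real"
  assumes "range a \<subseteq> {0, 1}"
  shows "(\<Sum>k. a k * (1/3) ^ k) = a 0 + (\<Sum>k. a (Suc k) * (1/3) ^ k) / 3"
proof -
  have "range (\<lambda>k. a (Suc k)) \<subseteq> {0, 1}" using assms by auto
  then have "summable (\<lambda>k. a (Suc k) * (1/3) ^ k)" by (rule ternary_bounds)
  then have "(\<Sum>k. a (Suc k) * (1/3) ^ k) / 3 = (\<Sum>k. a (Suc k) * (1/3) ^ k / 3)"
    by (rule suminf_divide[symmetric])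
  also have "\<dots> = (\<Sum>k. a k * (1/3) ^ k) - a 0"
    using suminf_split_head[OF ternary_bounds(1)[OF assms]] by (simp add: mult_ac)
  finally show ?thesis by linarith
qed

text \<open>If two sums first differ at digit \<open>j\<close>, that digit contributes
  \<open>(1/3) ^ j\<close> and all later ones together at most half of this. The gap is the reason
  for digits 0 and 1 in base 3; in base 2 there is none.\<close>

lemma ternary_digits_eq:
  fixes a b :: "nat \<Rightarrow> real"
  assumes "range a \<subseteq> {0, 1}" "range b \<subseteq> {0, 1}"
    and "\<bar>(\<Sum>k. a k * (1/3) ^ k) - (\<Sum>k. b k * (1/3) ^ k)\<bar> < (1/3) ^ n / 2" and "k \<le> n"
  shows "a k = b k"
  using assms
proof (induction n arbitrary: a b k)
  case (0 a b k)
  have r: "range (\<lambda>k. a (Suc k)) \<subseteq> {0, 1}" "range (\<lambda>k. b (Suc k)) \<subseteq> {0, 1}" using 0 by auto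
  have "\<bar>a 0 - b 0\<bar> < 1"
    using ternary_bounds(2,3)[OF r(1)] ternary_bounds(2,3)[OF r(2)] 0(3)[unfolded power_0]
      ternary_split_head[OF 0(1)] ternary_split_head[OF 0(2)] by linarith
  moreover have "a 0 \<in> {0, 1}" "b 0 \<in> {0, 1}" using 0 by blast+
  ultimately show ?case using 0 by auto
next
  case (Suc n a b k)
  have r: "range (\<lambda>k. a (Suc k)) \<subseteq> {0, 1}" "range (\<lambda>k. b (Suc k)) \<subseteq> {0, 1}" using Suc.prems(1,2) by blast+
  have "(1/3 :: real) ^ Suc n \<le> 1" by (rule power_le_one) auto
  then have "\<bar>a 0 - b 0\<bar> < 1"
    using ternary_bounds(2,3)[OF r(1)] ternary_bounds(2,3)[OF r(2)] Suc.prems(3)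
      ternary_split_head[OF Suc.prems(1)] ternary_split_head[OF Suc.prems(2)] by linarith
  moreover have "a 0 \<in> {0, 1}" "b 0 \<in> {0, 1}" using Suc.prems by blast+
  ultimately have 00: "a 0 = b 0" by auto
  show ?case
  proof (cases k)
    case 0
    then show ?thesis using 00 by simp
  next
    case (Suc k')
    have "(1/3 :: real) ^ Suc n = (1/3) ^ n / 3" by simp
    then have "\<bar>(\<Sum>k. a (Suc k) * (1/3) ^ k) - (\<Sum>k. b (Suc k) * (1/3) ^ k)\<bar> < (1/3) ^ n / 2"
      using Suc.prems(3) ternary_split_head[OF Suc.prems(1)] ternary_split_head[OF Suc.prems(2)] 00
      by linarith
    from Suc.IH[OF r this, of k'] Suc Suc.prems(4) show ?thesis by simp
  qed
qed

text \<open>Finite nets of every mesh, enumerated in one sequence. That one \<open>n\<close> serves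
  all points of \<open>X\<close> is what makes the decoding below uniformly continuous.\<close>

lemma compact_countable_fine_cover:
  fixes X :: "'x::metric_space set"
  assumes "compact X" "X \<noteq> {}"
  shows "\<exists>U :: nat \<Rightarrow> 'x set. (\<forall>k. open (U k)) \<and>
    (\<forall>e>0. \<exists>n. \<forall>x\<in>X. \<exists>k\<le>n. x \<in> U k \<and> (\<forall>y\<in>U k. dist x y < e))"
proof -
  have "\<forall>n. \<exists>F. finite F \<and> F \<subseteq> X \<and> X \<subseteq> (\<Union>x\<in>F. ball x (1 / real (Suc n)))"
    using seq_compact_imp_totally_bounded[of X] assms(1) by (simp add: compact_eq_seq_compact_metric)
  then obtain F where F: "\<And>n. finite (F n)" "\<And>n. X \<subseteq> (\<Union>x\<in>F n. ball x (1 / real (Suc n)))" by metis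
  define \<B> where "\<B> n = (\<lambda>x. ball x (1 / real (Suc n))) ` F n" for n
  define U where "U = from_nat_into (\<Union>n. \<B> n)"
  have "F 0 \<noteq> {}" using F(2)[of 0] assms by auto
  then have ne: "(\<Union>n. \<B> n) \<noteq> {}" by (auto simp: \<B>_def)
  have count: "countable (\<Union>n. \<B> n)" using F(1) unfolding \<B>_def by (intro countable_UN countable_image) (auto intro: countable_finite)
  have rng: "range U = (\<Union>n. \<B> n)" unfolding U_def by (rule range_from_nat_into[OF ne count])
  have "open (U k)" for k
  proof -
    have "U k \<in> (\<Union>n. \<B> n)" using rng by blast
    then show ?thesis by (auto simp: \<B>_def)
  qed
  moreover have "\<exists>n. \<forall>x\<in>X. \<exists>k\<le>n. x \<in> U k \<and> (\<forall>y\<in>U k. dist x y < e)" if e: "0 < e" for e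
  proof -
    obtain n where n: "inverse (real (Suc n)) < e / 2" using reals_Archimedean[of "e / 2"] e by auto
    have "\<B> n \<subseteq> range U" using rng by blast
    moreover have "finite (\<B> n)" using F by (simp add: \<B>_def)
    ultimately obtain C where C: "finite C" "\<B> n = U ` C" by (metis finite_subset_image)
    have "\<exists>k\<le>Max C. x \<in> U k \<and> (\<forall>y\<in>U k. dist x y < e)" if "x \<in> X" for x
    proof -
      obtain a where a: "a \<in> F n" "x \<in> ball a (1 / real (Suc n))" using F(2)[of n] \<open>x \<in> X\<close> by blast
      then have "ball a (1 / real (Suc n)) \<in> U ` C" using C(2) unfolding \<B>_def by blast
      then obtain k where k: "k \<in> C" "U k = ball a (1 / real (Suc n))" by (metis imageE)
      have "dist x y < e" if "y \<in> U k" for y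
      proof -
        have "dist a x < e / 2" "dist a y < e / 2" using a k that n by (auto simp: inverse_eq_divide)
        then show ?thesis by (metis dist_commute dist_triangle_half_l)
      qed
      then show ?thesis using k a C(1) by (intro exI[of _ k]) auto
    qed
    then show ?thesis by blast
  qed
  ultimately show ?thesis by blast
qed

text \<open>Digit \<open>k\<close> of the code tells whether the point lies in \<open>U k\<close>.
  The code is merely Borel, but close codes share their first digits and hence a small
  \<open>U k\<close>: it is the inverse that is uniformly continuous.\<close>

lemma borel_code:
  fixes X :: "'x::metric_space set"
  assumes "compact X" "X \<noteq> {}"
  shows "\<exists>g :: 'x \<Rightarrow> real. g \<in> borel_measurable borel \<and> (\<forall>x. g x \<in> {0..3/2}) \<and>
    (\<forall>e>0. \<exists>\<delta>>0. \<forall>x\<in>X. \<forall>y\<in>X. \<bar>g x - g y\<bar> < \<delta> \<longrightarrow> dist x y < e)"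
proof -
  obtain U :: "nat \<Rightarrow> 'x set" where U: "\<And>k. open (U k)"
    "\<And>e. e > 0 \<Longrightarrow> \<exists>n. \<forall>x\<in>X. \<exists>k\<le>n. x \<in> U k \<and> (\<forall>y\<in>U k. dist x y < e)"
    using compact_countable_fine_cover[OF assms] by metis
  define a :: "'x \<Rightarrow> nat \<Rightarrow> real" where "a x k = indicator (U k) x" for x k
  define g where "g x = (\<Sum>k. a x k * (1/3) ^ k)" for x
  have a: "range (a x) \<subseteq> {0, 1}" for x by (auto simp: a_def indicator_def)
  have "g \<in> borel_measurable borel"
    unfolding g_def a_def using U(1) by (intro borel_measurable_suminf borel_measurable_times borel_measurable_indicator) auto
  moreover have "g x \<in> {0..3/2}" for x using ternary_bounds[OF a] by (simp add: g_def)
  moreover have "\<exists>\<delta>>0. \<forall>x\<in>X. \<forall>y\<in>X. \<bar>g x - g y\<bar> < \<delta> \<longrightarrow> dist x y < e" if e: "0 < e" for e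
  proof -
    obtain n where n: "\<forall>x\<in>X. \<exists>k\<le>n. x \<in> U k \<and> (\<forall>y\<in>U k. dist x y < e)" using U(2)[OF e] by blast
    have "dist x y < e" if "x \<in> X" "\<bar>g x - g y\<bar> < (1/3) ^ n / 2" for x y
    proof -
      obtain k where k: "k \<le> n" "x \<in> U k" "\<forall>y\<in>U k. dist x y < e" using n \<open>x \<in> X\<close> by blast
      have "a x k = a y k" by (rule ternary_digits_eq[OF a a _ k(1)]) (use that in \<open>simp add: g_def\<close>)
      then have "y \<in> U k" using k by (auto simp: a_def indicator_def split: if_splits)
      then show ?thesis using k by blast
    qed
    then show ?thesis by (intro exI[of _ "(1/3) ^ n / 2"]) auto
  qed
  ultimately show ?thesis by blast
qed

text \<open>Uniform continuity extends the decoding to the closure of the codes, with limits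
  provided by compactness of \<open>X\<close>. \<open>R c x\<close> describes \<open>x\<close> as a
  limit of points whose codes tend to \<open>c\<close>; uniform continuity makes this
  \<open>x\<close> unique.\<close>

lemma code_inverse:
  fixes X :: "'x::metric_space set" and g :: "'x \<Rightarrow> real"
  assumes X: "compact X"
    and g: "\<And>e. e > 0 \<Longrightarrow> \<exists>\<delta>>0. \<forall>x\<in>X. \<forall>y\<in>X. \<bar>g x - g y\<bar> < \<delta> \<longrightarrow> dist x y < e"
  shows "\<exists>h. continuous_on (closure (g ` X)) h \<and> h ` closure (g ` X) \<subseteq> X \<and> (\<forall>x\<in>X. h (g x) = x)"
proof -
  define R where "R c x \<longleftrightarrow> x \<in> X \<and> (\<exists>xs. (\<forall>n. xs n \<in> X) \<and> (\<lambda>n::nat. g (xs n)) \<longlonglongrightarrow> c \<and> xs \<longlonglongrightarrow> x)" for c x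
  have ex: "\<exists>x. R c x" if c: "c \<in> closure (g ` X)" for c
  proof -
    obtain f where f: "\<And>n::nat. f n \<in> g ` X" "f \<longlonglongrightarrow> c" using c unfolding closure_sequential by blast
    then have "\<forall>n. \<exists>x. x \<in> X \<and> f n = g x" by blast
    then obtain xs where xs: "\<And>n. xs n \<in> X" "\<And>n. f n = g (xs n)" by metis
    obtain x r where r: "x \<in> X" "strict_mono r" "(xs \<circ> r) \<longlonglongrightarrow> x"
      using X xs(1) unfolding compact_eq_seq_compact_metric seq_compact_def by meson
    have "(f \<circ> r) \<longlonglongrightarrow> c" using f(2) r(2) by (rule LIMSEQ_subseq_LIMSEQ)
    then show ?thesis unfolding R_def using r xs by (intro exI[of _ x] conjI exI[of _ "xs \<circ> r"]) (auto simp: o_def)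
  qed
  have close: "\<exists>\<delta>>0. \<forall>c c' x x'. R c x \<longrightarrow> R c' x' \<longrightarrow> \<bar>c - c'\<bar> < \<delta> \<longrightarrow> dist x x' \<le> e" if e: "0 < e" for e
  proof -
    obtain \<delta> where \<delta>: "\<delta> > 0" "\<forall>x\<in>X. \<forall>y\<in>X. \<bar>g x - g y\<bar> < \<delta> \<longrightarrow> dist x y < e" using g[OF e] by blast
    have "dist x x' \<le> e" if "R c x" "R c' x'" "\<bar>c - c'\<bar> < \<delta>" for c c' x x'
    proof -
      obtain xs where xs: "\<And>n. xs n \<in> X" "(\<lambda>n::nat. g (xs n)) \<longlonglongrightarrow> c" "xs \<longlonglongrightarrow> x" using \<open>R c x\<close> by (auto simp: R_def)
      obtain ys where ys: "\<And>n. ys n \<in> X" "(\<lambda>n::nat. g (ys n)) \<longlonglongrightarrow> c'" "ys \<longlonglongrightarrow> x'" using \<open>R c' x'\<close> by (auto simp: R_def)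
      have "(\<lambda>n. \<bar>g (xs n) - g (ys n)\<bar>) \<longlonglongrightarrow> \<bar>c - c'\<bar>" using xs ys by (intro tendsto_intros)
      then have "eventually (\<lambda>n. \<bar>g (xs n) - g (ys n)\<bar> < \<delta>) sequentially" using that(3) by (rule order_tendstoD)
      then have "eventually (\<lambda>n. dist (xs n) (ys n) \<le> e) sequentially"
        by eventually_elim (use \<delta> xs ys in \<open>auto intro: less_imp_le\<close>)
      moreover have "(\<lambda>n. dist (xs n) (ys n)) \<longlonglongrightarrow> dist x x'" using xs ys by (intro tendsto_intros)
      ultimately show ?thesis by (intro tendsto_upperbound) auto
    qed
    then show ?thesis using \<delta> by blast
  qed
  define h where "h c = (SOME x. R c x)" for c
  have h: "R c (h c)" if "c \<in> closure (g ` X)" for c unfolding h_def using ex[OF that] by (rule someI_ex)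
  have "continuous_on (closure (g ` X)) h"
    unfolding continuous_on_iff
  proof (intro ballI allI impI)
    fix c e assume c: "c \<in> closure (g ` X)" and e: "0 < (e::real)"
    obtain \<delta> where \<delta>: "\<delta> > 0" "\<forall>c c' x x'. R c x \<longrightarrow> R c' x' \<longrightarrow> \<bar>c - c'\<bar> < \<delta> \<longrightarrow> dist x x' \<le> e / 2"
      using close[of "e / 2"] e by auto
    have "dist (h c') (h c) < e" if "c' \<in> closure (g ` X)" "dist c' c < \<delta>" for c'
    proof -
      have "dist (h c') (h c) \<le> e / 2" using \<delta>(2) h[OF c] h[OF that(1)] that(2) by (auto simp: dist_real_def)
      then show ?thesis using e by simp
    qed
    then show "\<exists>d>0. \<forall>c'\<in>closure (g ` X). dist c' c < d \<longrightarrow> dist (h c') (h c) < e" using \<delta> by blast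
  qed
  moreover have "h ` closure (g ` X) \<subseteq> X" using h by (auto simp: R_def)
  moreover have "h (g x) = x" if x: "x \<in> X" for x
  proof -
    have "g x \<in> closure (g ` X)" using x by (intro closure_subset[THEN subsetD] imageI)
    then have 1: "R (g x) (h (g x))" by (rule h)
    have 2: "R (g x) x" unfolding R_def using x by (intro conjI exI[of _ "\<lambda>_. x"]) auto
    have "dist (h (g x)) x \<le> 0 + e" if "0 < e" for e
    proof -
      obtain \<delta> where "\<delta> > 0" "\<forall>c c' x x'. R c x \<longrightarrow> R c' x' \<longrightarrow> \<bar>c - c'\<bar> < \<delta> \<longrightarrow> dist x x' \<le> e"
        using close[OF \<open>0 < e\<close>] by blast
      then show ?thesis using 1 2 by auto
    qed
    then have "dist (h (g x)) x \<le> 0" by (rule field_le_epsilon)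
    then show ?thesis by simp
  qed
  ultimately show ?thesis by blast
qed

section \<open>Borel probability measures on a compact set and weak limits\<close>

lemma borel_prob_onD:
  assumes "borel_prob_on X \<mu>"
  shows "prob_space \<mu>" "sets \<mu> = sets (restrict_space borel X)" "space \<mu> = X"
  using assms sets_eq_imp_space_eq[of \<mu> "restrict_space borel X"]
  by (auto simp: borel_prob_on_def space_restrict_space)

lemma borel_prob_on_distr:
  assumes "prob_space M" "f \<in> borel_measurable M" "\<And>x. x \<in> space M \<Longrightarrow> f x \<in> X"
  shows "f \<in> M \<rightarrow>\<^sub>M restrict_space borel X" "borel_prob_on X (distr M (restrict_space borel X) f)"
proof -
  show f: "f \<in> M \<rightarrow>\<^sub>M restrict_space borel X"
    by (rule measurable_restrict_space2) (use assms in auto)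
  show "borel_prob_on X (distr M (restrict_space borel X) f)"
    unfolding borel_prob_on_def using prob_space.prob_space_distr[OF assms(1) f] by simp
qed

lemma borel_measurable_borel_prob_on:
  assumes "borel_prob_on X \<mu>" "continuous_on X f"
  shows "f \<in> borel_measurable \<mu>"
  using borel_measurable_continuous_on_restrict[OF assms(2)]
    measurable_cong_sets[OF borel_prob_onD(2)[OF assms(1)] refl] by blast

lemma integrable_continuous_compact:
  fixes f :: "'x::metric_space \<Rightarrow> real"
  assumes X: "compact X" and \<mu>: "borel_prob_on X \<mu>" and f: "continuous_on X f"
  shows "integrable \<mu> f"
proof -
  interpret prob_space \<mu> by (rule borel_prob_onD[OF \<mu>])
  have "bounded (f ` X)" using X f by (intro compact_imp_bounded compact_continuous_image)
  then obtain B where "\<forall>x\<in>X. norm (f x) \<le> B" by (auto simp: bounded_iff)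
  then show ?thesis
    using borel_measurable_borel_prob_on[OF \<mu> f] borel_prob_onD(3)[OF \<mu>]
    by (intro integrable_const_bound[of _ B]) auto
qed

text \<open>Traces of closed sets generate the \<sigma>-algebra and are stable under intersection;
  their measures are limits of integrals of the continuous functions
  \<open>max 0 (1 - real n * infdist x C)\<close>.\<close>

lemma borel_prob_on_eqI:
  fixes X :: "'x::metric_space set"
  assumes X: "compact X" and \<mu>: "borel_prob_on X \<mu>" and \<nu>: "borel_prob_on X \<nu>"
    and eq: "\<And>f :: 'x \<Rightarrow> real. continuous_on X f \<Longrightarrow> integral\<^sup>L \<mu> f = integral\<^sup>L \<nu> f"
  shows "\<mu> = \<nu>"
proof -
  have Xb: "X \<in> sets borel" using X by (simp add: compact_imp_closed borel_closed)
  have closed_lim: "(\<lambda>n. integral\<^sup>L M (\<lambda>x. max 0 (1 - real n * infdist x C))) \<longlonglongrightarrow> measure M (X \<inter> C)"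
    if M: "borel_prob_on X M" and C: "closed C" "C \<noteq> {}" for M and C :: "'x set"
  proof -
    interpret prob_space M by (rule borel_prob_onD[OF M])
    have XC: "X \<inter> C \<in> sets M"
      using C borel_prob_onD(2)[OF M] by (auto simp: sets_restrict_space)
    have "(\<lambda>n. integral\<^sup>L M (\<lambda>x. max 0 (1 - real n * infdist x C))) \<longlonglongrightarrow> integral\<^sup>L M (indicator (X \<inter> C) :: 'x \<Rightarrow> real)"
    proof (rule integral_dominated_convergence[where w = "\<lambda>_. 1"])
      show "(\<lambda>x. max 0 (1 - real n * infdist x C)) \<in> borel_measurable M" for n
        by (rule borel_measurable_borel_prob_on[OF M]) (intro continuous_intros)
      show "(indicator (X \<inter> C) :: 'x \<Rightarrow> real) \<in> borel_measurable M" using XC by simp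
      show "AE x in M. (\<lambda>n. max 0 (1 - real n * infdist x C)) \<longlonglongrightarrow> indicator (X \<inter> C) x"
      proof (rule AE_I2)
        fix x assume "x \<in> space M"
        then have x: "x \<in> X" using borel_prob_onD(3)[OF M] by simp
        show "(\<lambda>n. max 0 (1 - real n * infdist x C)) \<longlonglongrightarrow> indicator (X \<inter> C) x"
        proof (cases "x \<in> C")
          case True
          then show ?thesis using x by simp
        next
          case False
          have "infdist x C \<noteq> 0" using False C in_closed_iff_infdist_zero by blast
          then have pos: "infdist x C > 0" using infdist_nonneg[of x C] by simp
          obtain N :: nat where N: "1 / infdist x C < real N" using reals_Archimedean2 by blast
          have "max 0 (1 - real n * infdist x C) = 0" if "n \<ge> N" for n
          proof -
            have "1 / infdist x C \<le> real n" using N that by linarith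
            then show ?thesis using pos by (simp add: pos_divide_le_eq)
          qed
          then have "eventually (\<lambda>n. max 0 (1 - real n * infdist x C) = 0) sequentially"
            unfolding eventually_sequentially by blast
          then show ?thesis using False by (simp add: tendsto_eventually)
        qed
      qed
      show "AE x in M. norm (max 0 (1 - real n * infdist x C)) \<le> 1" for n
        by (rule AE_I2) (auto simp: infdist_nonneg)
    qed simp_all
    also have "integral\<^sup>L M (indicator (X \<inter> C) :: 'x \<Rightarrow> real) = measure M (X \<inter> C)"
      using XC by simp
    finally show ?thesis .
  qed
  interpret \<mu>: prob_space \<mu> by (rule borel_prob_onD[OF \<mu>])
  interpret \<nu>: prob_space \<nu> by (rule borel_prob_onD[OF \<nu>])
  have sets: "sets (restrict_space borel X) = sigma_sets X ((\<inter>) X ` Collect closed)"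
    using sigma_sets_Int[of X UNIV "Collect closed"] Xb
    by (simp add: sets_restrict_space borel_eq_closed)
  show ?thesis
  proof (rule measure_eqI_generator_eq[where E = "(\<inter>) X ` Collect closed" and \<Omega> = X and A = "\<lambda>_. X"])
    show "Int_stable ((\<inter>) X ` Collect closed)"
      unfolding Int_stable_def
    proof (intro ballI)
      fix a b assume "a \<in> (\<inter>) X ` Collect closed" "b \<in> (\<inter>) X ` Collect closed"
      then obtain C D where "a = X \<inter> C" "b = X \<inter> D" "closed C" "closed D" by auto
      then show "a \<inter> b \<in> (\<inter>) X ` Collect closed" by (intro image_eqI[of _ _ "C \<inter> D"]) auto
    qed
    fix A assume "A \<in> (\<inter>) X ` Collect closed"
    then obtain C where C: "closed C" "A = X \<inter> C" by auto
    show "emeasure \<mu> A = emeasure \<nu> A"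
    \<comment> \<open>By convention \<open>infdist\<close> to the empty set is 0, so the
      approximating functions would be constantly 1 there.\<close>
    proof (cases "C = {}")
      case False
      have "continuous_on X (\<lambda>x. max 0 (1 - real n * infdist x C))" for n by (intro continuous_intros)
      then have "measure \<mu> A = measure \<nu> A"
        using LIMSEQ_unique[OF closed_lim[OF \<mu> C(1) False]] closed_lim[OF \<nu> C(1) False] eq C(2) by simp
      then show ?thesis by (simp add: \<mu>.emeasure_eq_measure \<nu>.emeasure_eq_measure)
    qed (use C in simp)
  next
    show "range (\<lambda>_. X) \<subseteq> (\<inter>) X ` Collect closed" by (auto intro: image_eqI[of _ _ UNIV])
  qed (use sets borel_prob_onD(2)[OF \<mu>] borel_prob_onD(2)[OF \<nu>] in auto)
qed

text \<open>A Borel injection \<open>g\<close> of \<open>X\<close> into the line whose inverse extends to a continuous map \<open>h\<close> on the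
  closure of its range reduces weak compactness on \<open>X\<close> to Helly's theorem.\<close>

theorem borel_prob_on_convergent_subsequence:
  fixes X :: "'x::metric_space set" and \<mu> :: "nat \<Rightarrow> 'x measure"
  assumes X: "compact X" and \<mu>: "\<And>n. borel_prob_on X (\<mu> n)"
  shows "\<exists>r m. strict_mono r \<and> borel_prob_on X m \<and>
    (\<forall>f :: 'x \<Rightarrow> real. continuous_on X f \<longrightarrow> (\<lambda>n. integral\<^sup>L (\<mu> (r n)) f) \<longlonglongrightarrow> integral\<^sup>L m f)"
proof -
  have "X \<noteq> {}" using prob_space.not_empty[OF borel_prob_onD(1)[OF \<mu>]] borel_prob_onD(3)[OF \<mu>] by simp
  then obtain x0 where x0: "x0 \<in> X" by blast
  obtain g :: "'x \<Rightarrow> real" where g: "g \<in> borel_measurable borel" "\<And>x. g x \<in> {0..3/2}"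
    "\<And>e. e > 0 \<Longrightarrow> \<exists>\<delta>>0. \<forall>x\<in>X. \<forall>y\<in>X. \<bar>g x - g y\<bar> < \<delta> \<longrightarrow> dist x y < e"
    using borel_code[OF X \<open>X \<noteq> {}\<close>] by metis
  define K where "K = closure (g ` X)"
  obtain h where h: "continuous_on K h" "\<And>c. c \<in> K \<Longrightarrow> h c \<in> X" "\<And>x. x \<in> X \<Longrightarrow> h (g x) = x"
    using code_inverse[OF X g(3)] unfolding K_def by blast
  have gK: "g x \<in> K" if "x \<in> X" for x unfolding K_def using that by (intro closure_subset[THEN subsetD] imageI)
  have K: "closed K" "K \<noteq> {}" using gK[OF x0] by (auto simp: K_def)
  have gm: "g \<in> borel_measurable (\<mu> n)" for n
  proof -
    have "g \<in> borel_measurable (restrict_space borel X)" using g(1) by (rule measurable_restrict_space1)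
    then show ?thesis using measurable_cong_sets[OF borel_prob_onD(2)[OF \<mu>] refl] by blast
  qed
  define law where "law n = distr (\<mu> n) borel g" for n
  have rd: "real_distribution (law n)" for n
    unfolding law_def by (rule prob_space.real_distribution_distr[OF borel_prob_onD(1)[OF \<mu>] gm])
  have "measure (law n) {-1<..2} = 1" for n
  proof -
    interpret prob_space "\<mu> n" by (rule borel_prob_onD[OF \<mu>])
    have "g -` {-1<..2} \<inter> space (\<mu> n) = space (\<mu> n)"
    proof -
      have "-1 < g x \<and> g x \<le> 2" for x using g(2)[of x] by simp
      then show ?thesis by auto
    qed
    then show ?thesis unfolding law_def using gm by (simp add: measure_distr prob_space)
  qed
  then have "tight law" unfolding tight_def using rd
    by (intro conjI allI impI exI[of _ "-1"] exI[of _ 2]) auto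
  then obtain r \<nu> where r: "strict_mono r" and \<nu>: "real_distribution \<nu>" and w: "weak_conv_m (law \<circ> r) \<nu>"
    using tight_imp_convergent_subsubsequence[of law "\<lambda>n. n"] by (auto simp: strict_mono_id[unfolded id_def] o_def)
  interpret \<nu>: real_distribution \<nu> by (rule \<nu>)
  have conv: "(\<lambda>n. integral\<^sup>L (\<mu> (r n)) (\<lambda>x. F (g x))) \<longlonglongrightarrow> integral\<^sup>L \<nu> F"
    if F: "continuous_on UNIV F" "\<And>x. norm (F x) \<le> B" for F :: "real \<Rightarrow> real" and B
  proof -
    have Fm: "F \<in> borel_measurable borel" using F(1) by (rule borel_measurable_continuous_onI)
    have "(\<lambda>n. integral\<^sup>L ((law \<circ> r) n) F) \<longlonglongrightarrow> integral\<^sup>L \<nu> F"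
      by (rule weak_conv_imp_integral_bdd_continuous_conv[OF _ \<nu> w, of F B])
        (use rd F in \<open>auto simp: o_def continuous_on_eq_continuous_at\<close>)
    moreover have "integral\<^sup>L ((law \<circ> r) n) F = integral\<^sup>L (\<mu> (r n)) (\<lambda>x. F (g x))" for n
      unfolding law_def o_def by (rule integral_distr[OF gm Fm])
    ultimately show ?thesis by simp
  qed
  have AE: "AE c in \<nu>. c \<in> K"
  proof -
    \<comment> \<open>A bounded continuous function that vanishes exactly on \<open>K\<close>. It
      integrates to 0 against every law of the codes, hence against the limit, which therefore lives
      on \<open>K\<close>.\<close>
    define D where "D c = min 1 (infdist c K)" for c
    have D: "continuous_on UNIV D" unfolding D_def by (intro continuous_intros)
    have D0: "0 \<le> D c" "D c \<le> 1" for c by (auto simp: D_def infdist_nonneg)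
    have "integral\<^sup>L (\<mu> (r n)) (\<lambda>x. D (g x)) = 0" for n
    proof -
      have "integral\<^sup>L (\<mu> (r n)) (\<lambda>x. D (g x)) = integral\<^sup>L (\<mu> (r n)) (\<lambda>x. 0)"
        by (rule Bochner_Integration.integral_cong) (use gK borel_prob_onD(3)[OF \<mu>] in \<open>auto simp: D_def\<close>)
      then show ?thesis by simp
    qed
    moreover have "(\<lambda>n. integral\<^sup>L (\<mu> (r n)) (\<lambda>x. D (g x))) \<longlonglongrightarrow> integral\<^sup>L \<nu> D"
      by (rule conv[OF D, of 1]) (use D0 in auto)
    ultimately have "integral\<^sup>L \<nu> D = 0" by (simp add: LIMSEQ_const_iff)
    moreover have "integrable \<nu> D"
      by (rule \<nu>.integrable_const_bound[of _ 1]) (use D0 borel_measurable_continuous_onI[OF D] in simp_all)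
    ultimately have "AE c in \<nu>. D c = 0"
      using D0 by (simp add: integral_nonneg_eq_0_iff_AE)
    then show ?thesis
    proof eventually_elim
      case (elim c)
      then have "infdist c K = 0" by (auto simp: D_def min_def split: if_splits)
      then show ?case using in_closed_iff_infdist_zero[OF K] by blast
    qed
  qed
  \<comment> \<open>The value \<open>x0\<close> on the null set outside \<open>K\<close> makes
    decoding a Borel map from the whole line into \<open>X\<close>.\<close>
  define h' where "h' c = (if c \<in> K then h c else x0)" for c
  have "h' \<in> borel_measurable borel"
    unfolding h'_def using K h by (intro borel_measurable_continuous_on_if) auto
  then have h'm: "h' \<in> borel_measurable \<nu>" by simp
  have h'X: "h' c \<in> X" for c using h(2) x0 by (simp add: h'_def)
  define m where "m = distr \<nu> (restrict_space borel X) h'"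
  note distr = borel_prob_on_distr[OF \<nu>.prob_space_axioms h'm h'X]
  have "(\<lambda>n. integral\<^sup>L (\<mu> (r n)) f) \<longlonglongrightarrow> integral\<^sup>L m f" if f: "continuous_on X f" for f :: "'x \<Rightarrow> real"
  proof -
    have "bounded (f ` X)" using X f by (intro compact_imp_bounded compact_continuous_image)
    then obtain B where B: "\<And>x. x \<in> X \<Longrightarrow> norm (f x) \<le> B" by (auto simp: bounded_iff)
    have "0 \<le> B" using B[OF x0] norm_ge_zero order_trans by blast
    have "continuous_on K (\<lambda>c. f (h c))"
      by (rule continuous_on_compose2[OF f h(1)]) (use h(2) in auto)
    \<comment> \<open>Weak convergence tests functions on the whole line, whereas the decoded
      \<open>f\<close> is given only on \<open>K\<close>; Tietze extends it with the same
      bound.\<close>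
    then obtain F where F: "continuous_on UNIV F" "\<And>c. c \<in> K \<Longrightarrow> F c = f (h c)" "\<And>c. norm (F c) \<le> B"
      using Tietze[of K "\<lambda>c. f (h c)" UNIV B] K(1) \<open>0 \<le> B\<close> B h(2) by auto
    have "integral\<^sup>L m f = integral\<^sup>L \<nu> (\<lambda>c. f (h' c))"
      unfolding m_def by (rule integral_distr[OF distr(1) borel_measurable_continuous_on_restrict[OF f]])
    also have "\<dots> = integral\<^sup>L \<nu> F"
    proof (rule integral_cong_AE)
      have "f \<in> borel_measurable (restrict_space borel X)" by (rule borel_measurable_continuous_on_restrict[OF f])
      then show "(\<lambda>c. f (h' c)) \<in> borel_measurable \<nu>" by (rule measurable_compose[OF distr(1)])
      show "F \<in> borel_measurable \<nu>" using borel_measurable_continuous_onI[OF F(1)] by simp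
      show "AE c in \<nu>. f (h' c) = F c" using AE by eventually_elim (simp add: h'_def F)
    qed
    finally have "integral\<^sup>L m f = integral\<^sup>L \<nu> F" .
    moreover have "integral\<^sup>L (\<mu> (r n)) (\<lambda>x. F (g x)) = integral\<^sup>L (\<mu> (r n)) f" for n
      by (rule Bochner_Integration.integral_cong) (use gK F(2) h(3) borel_prob_onD(3)[OF \<mu>] in auto)
    ultimately show ?thesis using conv[OF F(1,3)] by simp
  qed
  then show ?thesis using r distr(2) unfolding m_def by blast
qed

subsection \<open>Invariant measures of flows\<close>

lemma integral_uniform_measure_Icc:
  fixes G :: "real \<Rightarrow> real"
  assumes G: "continuous_on UNIV G" and N: "0 < N"
  shows "integral\<^sup>L (uniform_measure lborel {0..N}) G = integral {0..N} G / N"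
proof -
  have eq: "uniform_measure lborel {0..N} = density lborel (\<lambda>x. ennreal (indicator {0..N} x / N))"
    unfolding uniform_measure_def using N
    by (intro arg_cong[where f = "density lborel"] ext) (auto simp: indicator_def divide_ennreal[of 1, simplified])
  have Gm: "G \<in> borel_measurable lborel" using G by (auto intro: borel_measurable_continuous_onI)
  have "integral\<^sup>L (uniform_measure lborel {0..N}) G = (LINT x|lborel. (indicator {0..N} x / N) *\<^sub>R G x)"
    unfolding eq by (rule integral_density[OF Gm]) (use N in auto)
  also have "\<dots> = (LINT x:{0..N}|lborel. G x) / N"
    by (simp add: set_lebesgue_integral_def)
  also have "(LINT x:{0..N}|lborel. G x) = integral {0..N} G"
    by (rule set_borel_integral_eq_integral(2)[OF borel_integrable_atLeastAtMost'])
      (use G continuous_on_subset in blast)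
  finally show ?thesis .
qed

text \<open>The translated integral runs over \<open>{t..N + t}\<close>; comparison with
  \<open>{0..N}\<close> leaves one piece of length \<open>t\<close> at each end.\<close>

lemma integral_translate_diff_le:
  fixes G :: "real \<Rightarrow> real"
  assumes G: "continuous_on UNIV G" and B: "\<And>s. \<bar>G s\<bar> \<le> B" and t: "0 \<le> t" and N: "0 \<le> N"
  shows "\<bar>integral {0..N} (\<lambda>s. G (s + t)) - integral {0..N} G\<bar> \<le> 2 * B * t"
proof -
  have int: "G integrable_on {a..b}" for a b
    by (rule integrable_continuous_real) (use G continuous_on_subset in blast)
  have bound: "\<bar>integral {a..a + t} G\<bar> \<le> B * t" for a
    using integral_bound[of a "a + t" G B] t B continuous_on_subset[OF G, of "{a..a + t}"] by simp
  have "integral {0..N} (\<lambda>s. G (s + t)) = integral {t..N + t} G"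
    using integral_shift_real_ivl[of t t "N + t" G] by simp
  moreover have "integral {0..t} G + integral {t..N + t} G = integral {0..N + t} G"
    by (rule Henstock_Kurzweil_Integration.integral_combine) (use t N int in auto)
  moreover have "integral {0..N} G + integral {N..N + t} G = integral {0..N + t} G"
    by (rule Henstock_Kurzweil_Integration.integral_combine) (use t N int in auto)
  ultimately show ?thesis using bound[of 0] bound[of N] by (simp add: abs_le_iff)
qed

text \<open>\<open>m\<close> is a weak limit of time averages along the orbit of \<open>y\<close>.
  Averages of \<open>f\<close> and of its translate by \<open>t\<close> differ by at most
  \<open>2 * B * t\<close> divided by the averaging time. The last conjunct records that
  \<open>m\<close> lives on the closure of the orbit.\<close>

theorem krylov_bogoliubov:
  fixes X :: "'x::metric_space set" and \<phi> :: "real \<Rightarrow> 'x \<Rightarrow> 'x"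
  assumes X: "compact X" and y: "y \<in> X"
    and map: "\<And>t x. x \<in> X \<Longrightarrow> \<phi> t x \<in> X"
    and zero: "\<And>x. x \<in> X \<Longrightarrow> \<phi> 0 x = x"
    and add: "\<And>s t x. x \<in> X \<Longrightarrow> \<phi> (s + t) x = \<phi> s (\<phi> t x)"
    and cont: "\<And>t. continuous_on X (\<phi> t)" and orbit: "continuous_on UNIV (\<lambda>t. \<phi> t y)"
  shows "\<exists>m. borel_prob_on X m \<and> (\<forall>t. distr m m (\<phi> t) = m) \<and>
    (\<forall>f :: 'x \<Rightarrow> real. continuous_on X f \<and> (\<forall>t. f (\<phi> t y) = 0) \<longrightarrow> integral\<^sup>L m f = 0)"
proof -
  define U where "U n = uniform_measure lborel {0..real (Suc n)}" for n
  have U: "prob_space (U n)" for n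
    unfolding U_def by (rule prob_space_uniform_measure) simp_all
  have om: "(\<lambda>t. \<phi> t y) \<in> borel_measurable (U n)" for n
    using borel_measurable_continuous_onI[OF orbit] by (simp add: U_def cong: measurable_cong_sets)
  define \<mu> where "\<mu> n = distr (U n) (restrict_space borel X) (\<lambda>t. \<phi> t y)" for n
  note distr = borel_prob_on_distr[OF U om map[OF y]]
  have \<mu>: "borel_prob_on X (\<mu> n)" for n unfolding \<mu>_def by (rule distr(2))
  have Gcont: "continuous_on UNIV (\<lambda>t. f (\<phi> t y))" if "continuous_on X f" for f :: "'x \<Rightarrow> real"
    by (rule continuous_on_compose2[OF that orbit]) (use map y in auto)
  have avg: "integral\<^sup>L (\<mu> n) f = integral {0..real (Suc n)} (\<lambda>t. f (\<phi> t y)) / real (Suc n)"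
    if f: "continuous_on X f" for f :: "'x \<Rightarrow> real" and n
  proof -
    have "integral\<^sup>L (\<mu> n) f = integral\<^sup>L (U n) (\<lambda>t. f (\<phi> t y))"
      unfolding \<mu>_def by (rule integral_distr[OF distr(1) borel_measurable_continuous_on_restrict[OF f]])
    also have "\<dots> = integral {0..real (Suc n)} (\<lambda>t. f (\<phi> t y)) / real (Suc n)"
      unfolding U_def by (rule integral_uniform_measure_Icc[OF Gcont[OF f]]) simp
    finally show ?thesis .
  qed
  obtain r m where r: "strict_mono r" and m: "borel_prob_on X m"
    and conv: "\<And>f :: 'x \<Rightarrow> real. continuous_on X f \<Longrightarrow> (\<lambda>n. integral\<^sup>L (\<mu> (r n)) f) \<longlonglongrightarrow> integral\<^sup>L m f"
    using borel_prob_on_convergent_subsequence[of X \<mu>, OF X \<mu>] by blast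
  have comp: "continuous_on X (\<lambda>x. f (\<phi> t x))" if "continuous_on X f" for f :: "'x \<Rightarrow> real" and t
    by (rule continuous_on_compose2[OF that cont]) (use map in auto)
  have inv_pos: "integral\<^sup>L m (\<lambda>x. f (\<phi> t x)) = integral\<^sup>L m f"
    if f: "continuous_on X f" and t: "0 \<le> t" for f :: "'x \<Rightarrow> real" and t
  proof -
    have "bounded (f ` X)" using X f by (intro compact_imp_bounded compact_continuous_image)
    then obtain B where "\<forall>x\<in>X. norm (f x) \<le> B" by (auto simp: bounded_iff)
    then have B: "\<bar>f (\<phi> s y)\<bar> \<le> B" for s using map[OF y] by auto
    define d where "d n = integral\<^sup>L (\<mu> n) (\<lambda>x. f (\<phi> t x)) - integral\<^sup>L (\<mu> n) f" for n
    have d: "\<bar>d n\<bar> \<le> 2 * B * t * inverse (real (Suc n))" for n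
    proof -
      have "d n = (integral {0..real (Suc n)} (\<lambda>s. f (\<phi> (s + t) y)) - integral {0..real (Suc n)} (\<lambda>s. f (\<phi> s y))) / real (Suc n)"
        unfolding d_def avg[OF f] avg[OF comp[OF f]] diff_divide_distrib
        using add[OF y, of t] by (simp add: add.commute)
      moreover have "\<bar>integral {0..real (Suc n)} (\<lambda>s. f (\<phi> (s + t) y)) - integral {0..real (Suc n)} (\<lambda>s. f (\<phi> s y))\<bar> \<le> 2 * B * t"
        by (rule integral_translate_diff_le[OF Gcont[OF f] B t]) simp
      ultimately have "\<bar>d n\<bar> \<le> (2 * B * t) / real (Suc n)"
        by (simp only: abs_divide abs_of_nat divide_right_mono of_nat_0_le_iff)
      then show ?thesis by (simp only: divide_inverse)
    qed
    have "d \<longlonglongrightarrow> 0"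
    proof (rule Lim_null_comparison)
      show "eventually (\<lambda>n. norm (d n) \<le> 2 * B * t * inverse (real (Suc n))) sequentially" using d by simp
      show "(\<lambda>n. 2 * B * t * inverse (real (Suc n))) \<longlonglongrightarrow> 0"
        using tendsto_mult_right_zero[OF LIMSEQ_inverse_real_of_nat] by simp
    qed
    then have "(d \<circ> r) \<longlonglongrightarrow> 0" using r by (rule LIMSEQ_subseq_LIMSEQ)
    moreover have "(d \<circ> r) \<longlonglongrightarrow> integral\<^sup>L m (\<lambda>x. f (\<phi> t x)) - integral\<^sup>L m f"
      unfolding d_def o_def by (intro tendsto_diff conv f comp)
    ultimately show ?thesis using LIMSEQ_unique by fastforce
  qed
  have inv: "integral\<^sup>L m (\<lambda>x. f (\<phi> t x)) = integral\<^sup>L m f" if f: "continuous_on X f" for f :: "'x \<Rightarrow> real" and t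
  proof (cases "0 \<le> t")
    case True
    then show ?thesis by (rule inv_pos[OF f])
  next
    \<comment> \<open>The nonnegative case is applied to the time \<open>- t\<close> and the
      function \<open>f\<close> composed with \<open>\<phi> t\<close>.\<close>
    case False
    have "integral\<^sup>L m (\<lambda>x. f (\<phi> t (\<phi> (- t) x))) = integral\<^sup>L m (\<lambda>x. f (\<phi> t x))"
      by (rule inv_pos[OF comp[OF f]]) (use False in simp)
    moreover have "integral\<^sup>L m (\<lambda>x. f (\<phi> t (\<phi> (- t) x))) = integral\<^sup>L m f"
      by (rule Bochner_Integration.integral_cong)
        (use add[symmetric] zero borel_prob_onD(3)[OF m] in auto)
    ultimately show ?thesis by simp
  qed
  have "distr m m (\<phi> t) = m" for t
  proof -
    have \<phi>m: "\<phi> t \<in> borel_measurable m" by (rule borel_measurable_borel_prob_on[OF m cont])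
    note dist = borel_prob_on_distr[OF borel_prob_onD(1)[OF m] \<phi>m, of X, unfolded borel_prob_onD(3)[OF m], OF map]
    have "distr m (restrict_space borel X) (\<phi> t) = m"
    proof (rule borel_prob_on_eqI[OF X dist(2) m])
      fix f :: "'x \<Rightarrow> real" assume f: "continuous_on X f"
      show "integral\<^sup>L (distr m (restrict_space borel X) (\<phi> t)) f = integral\<^sup>L m f"
        using integral_distr[OF dist(1) borel_measurable_continuous_on_restrict[OF f]] inv[OF f] by simp
    qed
    moreover have "distr m (restrict_space borel X) (\<phi> t) = distr m m (\<phi> t)"
      by (rule distr_cong) (use borel_prob_onD(2)[OF m] in auto)
    ultimately show ?thesis by simp
  qed
  moreover have "integral\<^sup>L m f = 0" if f: "continuous_on X f" "\<forall>t. f (\<phi> t y) = 0" for f :: "'x \<Rightarrow> real"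
    using conv[OF f(1)] f(2) by (simp add: avg[OF f(1)] LIMSEQ_const_iff)
  ultimately show ?thesis using m by blast
qed

subsection \<open>Visit times to cross-sections\<close>

lemma continuous_on_smooth_action:
  fixes act :: "'u::euclidean_space \<Rightarrow> 'x::topological_space \<Rightarrow> 'x"
  assumes "smooth_manifold X A" "smooth_action X A act"
  shows "continuous_on (UNIV \<times> X) (\<lambda>(u, x). act u x)"
proof -
  have "(\<Union>(D, \<phi>)\<in>prod_atlas (std_atlas (UNIV :: 'u set)) A. D) = UNIV \<times> (\<Union>(D, \<phi>)\<in>A. D)"
  proof (intro equalityI subsetI)
    fix p assume "p \<in> (UNIV :: 'u set) \<times> (\<Union>(D, \<phi>)\<in>A. D)"
    then obtain D \<phi> where "(D, \<phi>) \<in> A" "snd p \<in> D" by auto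
    then have "(UNIV \<times> D, map_prod (\<lambda>x. x) \<phi>) \<in> prod_atlas (std_atlas (UNIV :: 'u set)) A" "p \<in> UNIV \<times> D"
      by (auto simp: prod_atlas_def std_atlas_def mem_Times_iff)
    then show "p \<in> (\<Union>(D, \<phi>)\<in>prod_atlas (std_atlas (UNIV :: 'u set)) A. D)" by blast
  next
    fix p assume "p \<in> (\<Union>(D, \<phi>)\<in>prod_atlas (std_atlas (UNIV :: 'u set)) A. D)"
    then show "p \<in> (UNIV :: 'u set) \<times> (\<Union>(D, \<phi>)\<in>A. D)"
      by (auto simp: prod_atlas_def std_atlas_def)
  qed
  then have "(\<Union>(D, \<phi>)\<in>prod_atlas (std_atlas (UNIV :: 'u set)) A. D) = UNIV \<times> X"
    using assms(1) by (simp add: smooth_manifold_def)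
  then show ?thesis using assms(2) by (simp add: smooth_action_def smooth_map_def)
qed

locale vector_group_action =
  fixes X :: "'x::metric_space set" and act :: "'u::euclidean_space \<Rightarrow> 'x \<Rightarrow> 'x"
  assumes compact: "compact X"
    and act_in: "x \<in> X \<Longrightarrow> act u x \<in> X"
    and act_zero: "x \<in> X \<Longrightarrow> act 0 x = x"
    and act_add: "x \<in> X \<Longrightarrow> act (u + v) x = act u (act v x)"
    and continuous: "continuous_on (UNIV \<times> X) (\<lambda>(u, x). act u x)"
begin

lemma act_minus: "x \<in> X \<Longrightarrow> act (- u) (act u x) = x"
  using act_add[of x "- u" u] act_zero by simp

lemma tendsto_act:
  assumes "us \<longlonglongrightarrow> u" "xs \<longlonglongrightarrow> x" "\<And>n::nat. xs n \<in> X" "x \<in> X"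
  shows "(\<lambda>n. act (us n) (xs n)) \<longlonglongrightarrow> act u x"
proof -
  have "(\<lambda>n. (us n, xs n)) \<longlonglongrightarrow> (u, x)" using assms by (intro tendsto_Pair)
  then have "((\<lambda>(u, x). act u x) \<circ> (\<lambda>n. (us n, xs n))) \<longlonglongrightarrow> (\<lambda>(u, x). act u x) (u, x)"
    using continuous[unfolded continuous_on_sequentially, rule_format, of "(u, x)" "\<lambda>n. (us n, xs n)"]
      assms by simp
  then show ?thesis by (simp add: o_def)
qed

lemma continuous_on_act: "continuous_on X (act u)"
proof -
  have "continuous_on X (\<lambda>x. (u, x))" by (intro continuous_intros)
  then have "continuous_on X (\<lambda>x. (\<lambda>(u, x). act u x) (u, x))"
    by (rule continuous_on_compose2[OF continuous]) auto
  then show ?thesis by simp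
qed

lemma continuous_on_orbit:
  assumes "x \<in> X"
  shows "continuous_on UNIV (\<lambda>u. act u x)"
proof -
  have "continuous_on UNIV (\<lambda>u. (u, x))" by (intro continuous_intros)
  then have "continuous_on UNIV (\<lambda>u. (\<lambda>(u, x). act u x) (u, x))"
    by (rule continuous_on_compose2[OF continuous]) (use assms in auto)
  then show ?thesis by simp
qed

lemma invariant_measure_line:
  assumes "y \<in> X" "norm v = 1"
  shows "\<exists>m. borel_prob_on X m \<and> invariant_measure act (range (\<lambda>t. t *\<^sub>R v)) m \<and>
    (\<forall>f :: 'x \<Rightarrow> real. continuous_on X f \<and> (\<forall>t. f (act (t *\<^sub>R v) y) = 0) \<longrightarrow> integral\<^sup>L m f = 0)"
proof -
  have "continuous_on UNIV (\<lambda>t. act (t *\<^sub>R v) y)"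
    by (rule continuous_on_compose2[OF continuous_on_orbit[OF assms(1)]]) (auto intro!: continuous_intros)
  then have "\<exists>m. borel_prob_on X m \<and> (\<forall>t. distr m m (act (t *\<^sub>R v)) = m) \<and>
    (\<forall>f :: 'x \<Rightarrow> real. continuous_on X f \<and> (\<forall>t. f (act (t *\<^sub>R v) y) = 0) \<longrightarrow> integral\<^sup>L m f = 0)"
    by (intro krylov_bogoliubov[OF compact assms(1)])
      (simp_all add: act_in act_zero act_add scaleR_left_distrib continuous_on_act)
  then show ?thesis by (auto simp: invariant_measure_def)
qed

text \<open>Longer and longer segments of orbits that avoid \<open>O'\<close>, centred at their midpoints,
  accumulate at a complete line orbit that avoids \<open>O'\<close>.\<close>

lemma line_orbit_avoids:
  assumes O': "openin (top_of_set X) O'"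
    and avoid: "\<And>n::nat. \<exists>x\<in>X. \<exists>v. norm v = 1 \<and> (\<forall>t\<in>{0..real n}. act (t *\<^sub>R v) x \<notin> O')"
  shows "\<exists>y\<in>X. \<exists>v. norm v = 1 \<and> (\<forall>t. act (t *\<^sub>R v) y \<notin> O')"
proof -
  have "\<forall>n::nat. \<exists>p. fst p \<in> X \<and> norm (snd p) = 1 \<and> (\<forall>t\<in>{0..real n}. act (t *\<^sub>R snd p) (fst p) \<notin> O')"
    using avoid by fastforce
  then obtain p where p: "\<And>n. fst (p n) \<in> X" "\<And>n. norm (snd (p n)) = 1"
    "\<And>n t. t \<in> {0..real n} \<Longrightarrow> act (t *\<^sub>R snd (p n)) (fst (p n)) \<notin> O'" by metis
  define q where "q n = (act ((real n / 2) *\<^sub>R snd (p n)) (fst (p n)), snd (p n))" for n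
  have "q n \<in> X \<times> sphere 0 1" for n using p act_in by (simp add: q_def)
  moreover have "compact (X \<times> sphere (0::'u) 1)" using compact by (intro compact_Times) auto
  ultimately obtain l r where l: "l \<in> X \<times> sphere 0 1" "strict_mono r" "(q \<circ> r) \<longlonglongrightarrow> l"
    unfolding compact_eq_seq_compact_metric seq_compact_def by meson
  obtain y v where yv: "l = (y, v)" by fastforce
  have y: "y \<in> X" and v: "norm v = 1" using l(1) yv by auto
  have lim: "(\<lambda>n. fst (q (r n))) \<longlonglongrightarrow> y" "(\<lambda>n. snd (q (r n))) \<longlonglongrightarrow> v"
    using tendsto_fst[OF l(3)] tendsto_snd[OF l(3)] yv by (simp_all add: o_def)
  have "act (t *\<^sub>R v) y \<notin> O'" for t
  proof
    assume "act (t *\<^sub>R v) y \<in> O'"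
    moreover obtain W where W: "open W" "O' = X \<inter> W" using O' openin_open by blast
    moreover have "(\<lambda>n. act (t *\<^sub>R snd (q (r n))) (fst (q (r n)))) \<longlonglongrightarrow> act (t *\<^sub>R v) y"
      using lim y p act_in by (intro tendsto_act tendsto_intros) (auto simp: q_def)
    ultimately have "eventually (\<lambda>n. act (t *\<^sub>R snd (q (r n))) (fst (q (r n))) \<in> W) sequentially"
      by (auto intro: topological_tendstoD)
    \<comment> \<open>Time \<open>t\<close> from the midpoint is time
      \<open>t + real (r n) / 2\<close> from the start, which lies inside the segment once
      \<open>2 * \<bar>t\<bar> \<le> real (r n)\<close>.\<close>
    moreover have "eventually (\<lambda>n. nat \<lceil>2 * \<bar>t\<bar>\<rceil> \<le> r n) sequentially"
      using filterlim_subseq[OF l(2)] unfolding filterlim_at_top by blast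
    ultimately have "eventually (\<lambda>n. False) sequentially"
    proof eventually_elim
      case (elim n)
      have n: "2 * \<bar>t\<bar> \<le> real (r n)" using elim(2) by linarith
      have "act (t *\<^sub>R snd (q (r n))) (fst (q (r n))) = act ((t + real (r n) / 2) *\<^sub>R snd (p (r n))) (fst (p (r n)))"
        using p(1) by (simp add: q_def act_add[symmetric] scaleR_left_distrib)
      moreover have "t + real (r n) / 2 \<in> {0..real (r n)}" using n by (auto simp: abs_if split: if_splits)
      ultimately have "act (t *\<^sub>R snd (q (r n))) (fst (q (r n))) \<notin> O'" using p(3) by metis
      moreover have "act (t *\<^sub>R snd (q (r n))) (fst (q (r n))) \<in> X" using p(1) act_in by (simp add: q_def)
      ultimately show False using elim(1) W by blast
    qed
    then show False by simp
  qed
  then show ?thesis using y v by blast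
qed

lemma uniform_visit_time:
  assumes erg: "completely_uniquely_ergodic X act"
    and O': "openin (top_of_set X) O'" "O' \<noteq> {}"
  shows "\<exists>l. \<forall>x\<in>X. \<forall>v. norm v = 1 \<longrightarrow> (\<exists>t\<in>{0..l}. act (t *\<^sub>R v) x \<in> O')"
proof (rule ccontr)
  assume "\<not> ?thesis"
  then have "\<exists>x\<in>X. \<exists>v. norm v = 1 \<and> (\<forall>t\<in>{0..real n}. act (t *\<^sub>R v) x \<notin> O')" for n :: nat by blast
  then obtain y v where y: "y \<in> X" "norm v = 1" and out: "\<And>t. act (t *\<^sub>R v) y \<notin> O'"
    using line_orbit_avoids[OF O'(1)] by blast
  obtain \<mu> where \<mu>: "full_support X \<mu>"
    "\<And>H \<nu>. one_parameter_subgroup H \<Longrightarrow> H \<noteq> {0} \<Longrightarrow> borel_prob_on X \<nu> \<Longrightarrow> invariant_measure act H \<nu> \<Longrightarrow> \<nu> = \<mu>"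
    using erg unfolding completely_uniquely_ergodic_def by blast
  obtain m where m: "borel_prob_on X m" "invariant_measure act (range (\<lambda>t. t *\<^sub>R v)) m"
    "\<And>f :: 'x \<Rightarrow> real. continuous_on X f \<Longrightarrow> (\<And>t. f (act (t *\<^sub>R v) y) = 0) \<Longrightarrow> integral\<^sup>L m f = 0"
    using invariant_measure_line[OF y] by blast
  have "one_parameter_subgroup (range (\<lambda>t. t *\<^sub>R v))"
    unfolding one_parameter_subgroup_def
    by (intro exI[of _ "\<lambda>t. t *\<^sub>R v"] conjI) (auto intro!: continuous_intros simp: scaleR_left_distrib)
  moreover have "range (\<lambda>t. t *\<^sub>R v) \<noteq> {0}"
  proof
    assume "range (\<lambda>t. t *\<^sub>R v) = {0}"
    then have "1 *\<^sub>R v = 0" by blast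
    with y show False by simp
  qed
  ultimately have "m = \<mu>" using \<mu>(2) m by blast
  define Z where "Z = X - O'"
  have "closedin (top_of_set X) Z" using O'(1) unfolding Z_def by (metis closedin_diff closedin_topspace topspace_euclidean_subtopology)
  then have Z: "closed Z" using compact compact_imp_closed closedin_closed_trans by blast
  have orbit: "act (t *\<^sub>R v) y \<in> Z" for t using out act_in y by (simp add: Z_def)
  then have ne: "Z \<noteq> {}" by blast
  \<comment> \<open>A continuous function that is zero on the orbit and, within \<open>X\<close>,
    positive exactly on \<open>O'\<close>; its vanishing integral shows that \<open>O'\<close> is
    null for \<open>m\<close>.\<close>
  have cont: "continuous_on X (\<lambda>x. infdist x Z)" by (intro continuous_intros)
  have "integral\<^sup>L m (\<lambda>x. infdist x Z) = 0" by (rule m(3)[OF cont]) (simp add: orbit)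
  then have "AE x in m. infdist x Z = 0"
    using integral_nonneg_eq_0_iff_AE[OF integrable_continuous_compact[OF compact m(1) cont]]
    by (simp add: infdist_nonneg)
  then have "AE x in m. x \<notin> O'"
    by eventually_elim (use in_closed_iff_infdist_zero[OF Z ne] in \<open>auto simp: Z_def\<close>)
  moreover have "O' \<in> sets m"
  proof -
    obtain W where "open W" "O' = X \<inter> W" using O'(1) openin_open by blast
    then show ?thesis using borel_prob_onD(2)[OF m(1)] by (auto simp: sets_restrict_space)
  qed
  ultimately have "emeasure m O' = 0" using AE_iff_measurable[of O' m "\<lambda>x. x \<notin> O'"] borel_prob_onD(3)[OF m(1)] sets.sets_into_space
    by force
  moreover have "emeasure \<mu> O' > 0" using \<mu>(1) O' by (simp add: full_support_def)
  ultimately show False using \<open>m = \<mu>\<close> by simp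
qed

text \<open>Baire category replaces the openness of \<open>(b, s) \<mapsto> b.s\<close>: countably many translates of the
  compact sets \<open>cball 0 \<epsilon>.K j\<close> cover \<open>X\<close>.\<close>

lemma thickening_has_interior:
  assumes K: "\<And>j::nat. compact (K j)" "\<And>j. K j \<subseteq> X" and S: "S = (\<Union>j. K j)"
    and visit: "\<And>x. x \<in> X \<Longrightarrow> \<exists>g. act g x \<in> S" and e: "0 < \<epsilon>" and ne: "X \<noteq> {}"
  shows "\<exists>O'. openin (top_of_set X) O' \<and> O' \<noteq> {} \<and> O' \<subseteq> {act b s | b s. norm b \<le> \<epsilon> \<and> s \<in> S}"
proof -
  \<comment> \<open>Category needs countably many pieces: the balls
    \<open>cball d \<epsilon>\<close> about a countable dense set of \<open>d\<close> cover the
    group.\<close>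
  obtain Q :: "'u set" where Q: "countable Q" "\<And>U. open U \<Longrightarrow> U \<noteq> {} \<Longrightarrow> \<exists>d\<in>Q. d \<in> U"
    using countable_dense_setE by blast
  define T where "T g j = (\<lambda>p. act (fst p) (snd p)) ` (cball g \<epsilon> \<times> K j)" for g j
  have T: "compact (T g j)" "T g j \<subseteq> X" for g j
  proof -
    have "continuous_on (cball g \<epsilon> \<times> K j) (\<lambda>p. act (fst p) (snd p))"
      using continuous_on_subset[OF continuous, of "cball g \<epsilon> \<times> K j"] K(2) by (auto simp: case_prod_unfold)
    then show "compact (T g j)"
      unfolding T_def by (rule compact_continuous_image) (use K(1) in \<open>auto intro: compact_Times\<close>)
    show "T g j \<subseteq> X" using subsetD[OF K(2)] act_in by (auto simp: T_def)
  qed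
  have cover: "X = (\<Union>(g, j)\<in>Q \<times> UNIV. T g j)"
  proof
    show "X \<subseteq> (\<Union>(g, j)\<in>Q \<times> UNIV. T g j)"
    proof
      fix x assume x: "x \<in> X"
      obtain g where g: "act g x \<in> S" using visit[OF x] by blast
      then obtain j where j: "act g x \<in> K j" using S by blast
      obtain d where d: "d \<in> Q" "d \<in> ball (- g) \<epsilon>" using Q(2)[of "ball (- g) \<epsilon>"] e by auto
      have "- g \<in> cball d \<epsilon>" using d by (simp add: dist_commute)
      then have "x \<in> T d j" unfolding T_def using j act_minus[OF x, of g]
        by (intro image_eqI[of _ _ "(- g, act g x)"]) auto
      then show "x \<in> (\<Union>(g, j)\<in>Q \<times> UNIV. T g j)" using d by blast
    qed
  qed (use subsetD[OF T(2)] in auto)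
  have "\<exists>g j. top_of_set X interior_of T g j \<noteq> {}"
  proof (rule ccontr)
    assume no: "\<not> ?thesis"
    have "top_of_set X interior_of \<Union>((\<lambda>(g, j). T g j) ` (Q \<times> UNIV)) = {}"
    proof (rule Baire_category_alt)
      have "compact_space (top_of_set X)" using compact by (simp add: compact_space_subtopology)
      moreover have "Hausdorff_space (top_of_set X)" by (simp add: Hausdorff_space_subtopology)
      ultimately show "completely_metrizable_space (top_of_set X) \<or> locally_compact_space (top_of_set X) \<and> regular_space (top_of_set X)"
        using compact_imp_locally_compact_space compact_Hausdorff_imp_regular_space by blast
      show "countable ((\<lambda>(g, j). T g j) ` (Q \<times> (UNIV :: nat set)))" using Q by auto
      fix A assume "A \<in> (\<lambda>(g, j). T g j) ` (Q \<times> (UNIV :: nat set))"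
      then obtain g j where "A = T g j" by auto
      then show "closedin (top_of_set X) A \<and> top_of_set X interior_of A = {}"
        using no T compact_imp_closed closed_subset by metis
    qed
    then have "top_of_set X interior_of X = {}" using cover by simp
    then show False using ne by (simp add: interior_of_topspace[of "top_of_set X", simplified])
  qed
  then obtain g j where gj: "top_of_set X interior_of T g j \<noteq> {}" by blast
  define O1 where "O1 = top_of_set X interior_of T g j"
  have O1: "openin (top_of_set X) O1" "O1 \<noteq> {}" "O1 \<subseteq> T g j"
    using gj by (auto simp: O1_def interior_of_subset)
  \<comment> \<open>Acting by \<open>- g\<close> moves the interior found in the image of
    \<open>cball g \<epsilon> \<times> K j\<close> back to displacements of norm at most
    \<open>\<epsilon>\<close>.\<close>
  define O' where "O' = {x \<in> X. act g x \<in> O1}"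
  have "openin (top_of_set X) O'"
  proof -
    have "openin (top_of_set X) (X \<inter> act g -` O1)"
      by (rule continuous_openin_preimage[OF continuous_on_act _ O1(1)]) (use act_in in auto)
    moreover have "O' = X \<inter> act g -` O1" by (auto simp: O'_def)
    ultimately show ?thesis by simp
  qed
  moreover have "O' \<noteq> {}"
  proof -
    obtain x where x: "x \<in> O1" using O1 by blast
    then have "x \<in> X" using O1 T by blast
    then have "act (- g) x \<in> O'" using x act_minus[of x "- g"] act_in by (simp add: O'_def)
    then show ?thesis by blast
  qed
  moreover have "O' \<subseteq> {act b s | b s. norm b \<le> \<epsilon> \<and> s \<in> S}"
  proof
    fix x assume "x \<in> O'"
    then have x: "x \<in> X" "act g x \<in> T g j" using O1 by (auto simp: O'_def)
    then obtain b s where bs: "b \<in> cball g \<epsilon>" "s \<in> K j" "act g x = act b s" by (auto simp: T_def)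
    have "s \<in> X" using bs K by blast
    have "x = act (- g) (act b s)" using act_minus[OF x(1), of g] bs(3) by simp
    also have "\<dots> = act (b - g) s" using act_add[OF \<open>s \<in> X\<close>, of "- g" b] by simp
    finally have "x = act (b - g) s" .
    moreover have "norm (b - g) \<le> \<epsilon>" using bs(1) by (simp add: dist_norm norm_minus_commute)
    ultimately show "x \<in> {act b s | b s. norm b \<le> \<epsilon> \<and> s \<in> S}" using bs(2) S by blast
  qed
  ultimately show ?thesis by blast
qed

text \<open>The segment from \<open>x\<close> in direction \<open>v\<close> traces an orbit segment
  of the point \<open>act x x0\<close>. Within bounded time it meets the thickened cross-section in
  some \<open>act b s\<close>, and the correction by \<open>- b\<close> gives a true visit time at
  distance at most \<open>\<epsilon>\<close>.\<close>

lemma visits_dense_forest: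
  assumes erg: "completely_uniquely_ergodic X act"
    and K: "\<And>j::nat. compact (K j)" "\<And>j. K j \<subseteq> X" and S: "S = (\<Union>j. K j)"
    and visit: "\<And>x. x \<in> X \<Longrightarrow> \<exists>g. act g x \<in> S" and x0: "x0 \<in> X"
  shows "dense_forest {u. act u x0 \<in> S}"
proof (rule dense_forestI)
  fix \<epsilon> :: real assume "0 < \<epsilon>"
  then obtain O' where O': "openin (top_of_set X) O'" "O' \<noteq> {}"
    "O' \<subseteq> {act b s | b s. norm b \<le> \<epsilon> \<and> s \<in> S}"
    using thickening_has_interior[OF K S visit \<open>0 < \<epsilon>\<close>] x0 by blast
  obtain l where l: "\<And>x v. x \<in> X \<Longrightarrow> norm v = 1 \<Longrightarrow> \<exists>t\<in>{0..l}. act (t *\<^sub>R v) x \<in> O'"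
    using uniform_visit_time[OF erg O'(1,2)] by blast
  have "\<exists>t\<in>{0..l}. \<exists>y\<in>{u. act u x0 \<in> S}. dist (x + t *\<^sub>R v) y \<le> \<epsilon>" if v: "norm v = 1" for x v
  proof -
    obtain t where t: "t \<in> {0..l}" "act (t *\<^sub>R v) (act x x0) \<in> O'" using l[OF act_in[OF x0] v] by blast
    then obtain b s where bs: "act (t *\<^sub>R v) (act x x0) = act b s" "norm b \<le> \<epsilon>" "s \<in> S" using O'(3) by blast
    have s: "s \<in> X" using bs(3) S K(2) by blast
    have "act (x + t *\<^sub>R v) x0 = act b s" using bs(1) act_add[OF x0, of "t *\<^sub>R v" x] by (simp add: add.commute)
    then have "act (- b + (x + t *\<^sub>R v)) x0 = s" using act_add[OF x0, of "- b"] act_minus[OF s] by simp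
    then have "- b + (x + t *\<^sub>R v) \<in> {u. act u x0 \<in> S}" using bs(3) by simp
    moreover have "dist (x + t *\<^sub>R v) (- b + (x + t *\<^sub>R v)) \<le> \<epsilon>" using bs(2) by (simp add: dist_norm)
    ultimately show ?thesis using t(1) by blast
  qed
  then show "\<exists>l. \<forall>x v. norm v = 1 \<longrightarrow> (\<exists>t\<in>{0..l}. \<exists>y\<in>{u. act u x0 \<in> S}. dist (x + t *\<^sub>R v) y \<le> \<epsilon>)" by blast
qed

text \<open>For visit times \<open>u\<close> and \<open>v\<close> with \<open>u - v\<close> in
  \<open>B\<close>, the pairs \<open>(u - v, act v x0)\<close> and \<open>(0, act u x0)\<close> have
  the same image under the injective map.\<close>

lemma visits_uniform_discrete:
  assumes B: "0 \<in> interior B" and inj: "inj_on (\<lambda>(b, s). act b s) (B \<times> S)" and x0: "x0 \<in> X"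
  shows "uniform_discrete {u. act u x0 \<in> S}"
proof -
  obtain e where e: "0 < e" "ball 0 e \<subseteq> B" using B by (auto simp: mem_interior)
  have "u = v" if u: "act u x0 \<in> S" and v: "act v x0 \<in> S" and d: "dist u v < e" for u v
  proof -
    have "u - v \<in> B" "0 \<in> B" using e d by (auto simp: dist_norm subset_iff norm_minus_commute)
    moreover have "(\<lambda>(b, s). act b s) (u - v, act v x0) = (\<lambda>(b, s). act b s) (0, act u x0)"
      unfolding prod.case act_add[OF x0, of "u - v" v, symmetric] act_zero[OF act_in[OF x0]] by simp
    ultimately have "(u - v, act v x0) = (0, act u x0)"
      using u v by (intro inj_onD[OF inj]) blast+
    then show ?thesis by simp
  qed
  then show ?thesis unfolding uniform_discrete_def using e(1) by blast
qed

end

text \<open>An open subset of a subspace is a countable union of compact sets, and so is its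
  continuous image. \<open>S\<close> itself need not be closed, so these are the pieces for the
  category argument.\<close>

lemma cross_section_sigma_compact:
  fixes A :: "('x::metric_space, 'e::euclidean_space) chart set"
  assumes "cross_section X A act S"
  shows "\<exists>K :: nat \<Rightarrow> 'x set. (\<forall>j. compact (K j)) \<and> S = (\<Union>j. K j)"
proof -
  obtain V W W' and f :: "'e \<Rightarrow> 'x" where V: "subspace V" and W: "openin (top_of_set V) W" "closure W \<subseteq> W'"
    and f: "smooth_map (std_atlas W') A f" and S: "S = f ` W"
    using assms unfolding cross_section_def by blast
  have "continuous_on W' f" using f by (simp add: smooth_map_def std_atlas_def)
  moreover have "W \<subseteq> W'" using W(2) closure_subset by blast
  ultimately have f: "continuous_on W f" by (rule continuous_on_subset)
  obtain U where U: "open U" "W = V \<inter> U" using W(1) openin_open by blast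
  obtain C :: "nat \<Rightarrow> 'e set" where C: "\<And>n. compact (C n)" "\<Union>(range C) = U"
    using open_Union_compact_subsets[OF U(1)] by metis
  have VC: "compact (V \<inter> C n)" for n by (rule closed_Int_compact[OF closed_subspace[OF V] C(1)])
  have "V \<inter> C n \<subseteq> W" for n using U(2) C(2) by blast
  then have "compact (f ` (V \<inter> C n))" for n
    using compact_continuous_image[OF continuous_on_subset[OF f] VC] by blast
  moreover have "S = (\<Union>n. f ` (V \<inter> C n))" unfolding S U(2) C(2)[symmetric] by blast
  ultimately show ?thesis by (intro exI[of _ "\<lambda>n. f ` (V \<inter> C n)"]) simp
qed

theorem visit_times_uniform_discrete_dense_forest:
  fixes X :: "'x::metric_space set" and A :: "('x, 'e::euclidean_space) chart set"
    and act :: "'u::euclidean_space \<Rightarrow> 'x \<Rightarrow> 'x"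
  assumes X: "compact X" "smooth_manifold X A" "smooth_action X A act" "completely_uniquely_ergodic X act"
    and S: "cross_section X A act S" and x0: "x0 \<in> X"
  shows "uniform_discrete {u. act u x0 \<in> S}" "dense_forest {u. act u x0 \<in> S}"
proof -
  interpret vector_group_action X act
    by unfold_locales (use X continuous_on_smooth_action[OF X(2,3)] in \<open>auto simp: smooth_action_def\<close>)
  obtain B :: "'u set" where "0 \<in> interior B" "inj_on (\<lambda>(b, s). act b s) (B \<times> S)"
    using S unfolding cross_section_def by blast
  then show "uniform_discrete {u. act u x0 \<in> S}" using x0 by (rule visits_uniform_discrete)
  obtain K :: "nat \<Rightarrow> 'x set" where K: "\<And>j. compact (K j)" "S = (\<Union>j. K j)"
    using cross_section_sigma_compact[OF S] by metis
  have SX: "S \<subseteq> X" and visit: "\<And>x. x \<in> X \<Longrightarrow> \<exists>g. act g x \<in> S"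
    using S unfolding cross_section_def by blast+
  have "K j \<subseteq> X" for j using SX K(2) by blast
  then show "dense_forest {u. act u x0 \<in> S}"
    by (rule visits_dense_forest[OF X(4) K(1) _ K(2) visit x0])
qed

theorem theorem1p3:
  shows "(\<forall>(X :: 'x::metric_space set) (A :: ('x, real ^ 'n) chart set)
            (act :: real ^ 'd \<Rightarrow> 'x \<Rightarrow> 'x).
            compact X \<and> smooth_manifold X A \<and> smooth_action X A act \<and>
            discrete_stabilizers X act \<and> completely_uniquely_ergodic X act \<longrightarrow>
            (\<forall>S x0. cross_section X A act S \<and> x0 \<in> X \<longrightarrow>
               uniform_discrete {u. act u x0 \<in> S} \<and> dense_forest {u. act u x0 \<in> S}))
         \<and> (\<exists>Y :: (real ^ 'd) set. uniform_discrete Y \<and> dense_forest Y)"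
  using visit_times_uniform_discrete_dense_forest uniform_discrete_dense_forest_exists by blast

end
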